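(* Let $K$ be a compact strongly countable-dimensional space and let $L$ be a compact space such that $C_w(L)$ is homeomorphic to $C_w(M)\times E$ for some uncountable metrizable compact space $M$ and some topological space $E$. Then $C_p(K)$ and $C_w(L)$ are not homeomorphic.
   Context: All topological spaces are assumed to be Tychonoff, so compact spaces are compact Hausdorff. For a compact space $K$, $C(K)$ denotes the Banach space of all real-valued continuous functions on $K$ with the supremum norm. $C_w(K)$ denotes the set $C(K)$ equipped with the weak topology of this Banach space (the weakest topology making all norm-continuous linear functionals on $C(K)$ continuous). $C_p(K)$ denotes the set $C(K)$ equipped with the pointwise topology, i.e. the topology inherited from the product space $\mathbb{R}^K$. A normal space is strongly countable-dimensional if it can be represented as a countable union of closed finite-dimensional subspaces, where finite-dimensional means of finite covering dimension. *)

theory Defs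
  imports "HOL-Analysis.Analysis"
begin

definition tychonoff_space :: "'a topology \<Rightarrow> bool" where
  "tychonoff_space X \<longleftrightarrow> completely_regular_space X \<and> Hausdorff_space X"


subsection \<open>Covering dimension\<close>

text \<open>\<open>dim X \<le> n\<close>: every finite open cover has a finite open refinement of order at most
  \<open>n\<close>, i.e. no point lies in more than \<open>n + 1\<close> members of the refinement. The empty space
  (usually given dimension \<open>-1\<close>) satisfies this for every \<open>n\<close>.\<close>

definition covering_dim_le :: "'a topology \<Rightarrow> nat \<Rightarrow> bool" where
  "covering_dim_le X n \<longleftrightarrow>
     (\<forall>\<U>. finite \<U> \<and> (\<forall>U\<in>\<U>. openin X U) \<and> \<Union>\<U> = topspace X \<longrightarrow>
       (\<exists>\<V>. finite \<V> \<and> (\<forall>V\<in>\<V>. openin X V) \<and> \<Union>\<V> = topspace X \<and>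
            (\<forall>V\<in>\<V>. \<exists>U\<in>\<U>. V \<subseteq> U) \<and>
            (\<forall>x\<in>topspace X. card {V\<in>\<V>. x \<in> V} \<le> n + 1)))"

definition finite_dimensional_space :: "'a topology \<Rightarrow> bool" where
  "finite_dimensional_space X \<longleftrightarrow> (\<exists>n. covering_dim_le X n)"

definition strongly_countable_dimensional :: "'a topology \<Rightarrow> bool" where
  "strongly_countable_dimensional X \<longleftrightarrow>
     normal_space X \<and>
     (\<exists>\<F>. countable \<F> \<and>
          (\<forall>F\<in>\<F>. closedin X F \<and> finite_dimensional_space (subtopology X F)) \<and>
          \<Union>\<F> = topspace X)"


subsection \<open>The spaces C(K), Cp(K) and Cw(K)\<close>

text \<open>\<open>C(K)\<close> with the supremum metric. Its points are functions on \<open>topspace K\<close>, made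
  \<open>extensional\<close> (equal to \<open>undefined\<close> off \<open>topspace K\<close>); \<open>cfunspace\<close> also asks them to be
  bounded, which is automatic for compact \<open>K\<close>.\<close>

definition CK_metric :: "'a topology \<Rightarrow> ('a \<Rightarrow> real) metric" where
  "CK_metric K = cfunspace K euclidean_metric"

definition CK :: "'a topology \<Rightarrow> ('a \<Rightarrow> real) set" where
  "CK K = mspace (CK_metric K)"

lemma CK_compact:
  assumes "compact_space K"
  shows "CK K = {f \<in> extensional (topspace K). continuous_map K euclideanreal f}"
  using compactin_mspace_cfunspace[of K "euclidean_metric :: real metric"] assms
  by (auto simp: CK_def CK_metric_def compact_space_def)

definition C_p :: "'a topology \<Rightarrow> ('a \<Rightarrow> real) topology" where
  "C_p K = subtopology (powertop_real (topspace K)) (CK K)"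

text \<open>The norm-continuous linear functionals on \<open>C(K)\<close>. The vector space operations are
  pointwise on \<open>topspace K\<close>; functionals are HOL functions of which only the values on
  \<open>CK K\<close> matter.\<close>

definition CK_dual :: "'a topology \<Rightarrow> (('a \<Rightarrow> real) \<Rightarrow> real) set" where
  "CK_dual K =
     {\<phi>. (\<forall>f\<in>CK K. \<forall>g\<in>CK K. \<phi> (\<lambda>x\<in>topspace K. f x + g x) = \<phi> f + \<phi> g) \<and>
         (\<forall>c. \<forall>f\<in>CK K. \<phi> (\<lambda>x\<in>topspace K. c * f x) = c * \<phi> f) \<and>
         continuous_map (mtopology_of (CK_metric K)) euclideanreal \<phi>}"

definition C_w :: "'a topology \<Rightarrow> ('a \<Rightarrow> real) topology" where
  "C_w K = topology_generated_by
     {{f \<in> CK K. \<phi> f \<in> U} |\<phi> U. \<phi> \<in> CK_dual K \<and> open U}"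

lemma topspace_C_p: "topspace (C_p K) = CK K"
  by (auto simp: C_p_def CK_def CK_metric_def PiE_def)

lemma topspace_C_w: "topspace (C_w K) = CK K"
proof -
  have "(\<lambda>_. 0) \<in> CK_dual K"
    by (simp add: CK_dual_def)
  then have "CK K \<in> {{f \<in> CK K. \<phi> f \<in> U} |\<phi> U. \<phi> \<in> CK_dual K \<and> open U}"
    by (auto intro!: exI[of _ "\<lambda>_. 0"] exI[of _ UNIV])
  then show ?thesis
    unfolding C_w_def topology_generated_by_topspace by blast
qed

end

theory Submission
  imports Defs
begin

text \<open>
  Suppose \<open>\<Phi>\<close> is a homeomorphism of \<open>C\<^sub>w(M) \<times> E\<close> onto \<open>C\<^sub>p(K)\<close> and let \<open>Q\<close> be the Hilbert cube.
  There is a weak-star continuous family \<open>\<mu>\<^sub>p\<close>, \<open>p \<in> Q\<close>, of linearly independent functionals on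
  \<open>C(M)\<close>. By continuity of \<open>\<mu>\<^sub>p\<close> at \<open>0\<close> there are, for each \<open>p\<close>, a finite \<open>A \<subseteq> K\<close> and a \<open>k\<close>
  such that \<open>\<bar>\<mu>\<^sub>p\<bar> \<le> 1\<close> wherever \<open>\<Phi>\<close> is \<open>1/(k+1)\<close>-close on \<open>A\<close> to its value at the origin; say
  that \<open>A\<close> controls \<open>p\<close>. A given \<open>A\<close> controls only finitely many \<open>p\<close>: a neighbourhood of \<open>0\<close> in
  \<open>C\<^sub>w(M)\<close> contains a subspace \<open>\<nu>\<^sub>1 = \<dots> = \<nu>\<^sub>n = 0\<close>, on which \<open>\<mu>\<^sub>p\<close> is bounded and hence zero.
  Conversely only finitely many sets of the least possible size control a given \<open>p\<close>.

  The relation ``the tuple \<open>x\<close> controls \<open>p\<close>'' is closed in \<open>Q \<times> K\<^sup>m\<close>. Cut down to products of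
  finite-dimensional closed pieces of \<open>K\<close> it is a compact space, finite-to-one over a
  finite-dimensional one, hence finite-dimensional. The points of \<open>Q\<close> over which it has between
  \<open>1\<close> and \<open>r\<close> points then admit, for sufficiently many coordinates \<open>i\<close>, disjoint open sets
  that miss the faces \<open>p\<^sub>i = 1\<close> and \<open>p\<^sub>i = 0\<close> respectively and together cover them. Countably many
  such sets of points exhaust \<open>Q\<close>, which Kuhn's combinatorial lemma and compactness forbid.
\<close>

subsection \<open>The Hilbert cube\<close>

definition hilbert_cube :: "(nat \<Rightarrow> real) set" where
  "hilbert_cube = (\<Pi>\<^sub>E i\<in>UNIV. {0..1})"

lemma mem_hilbert_cube: "p \<in> hilbert_cube \<longleftrightarrow> (\<forall>i. 0 \<le> p i \<and> p i \<le> 1)"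
  by (auto simp: hilbert_cube_def PiE_iff)

lemma compact_hilbert_cube: "compact hilbert_cube"
proof -
  have "compactin (product_topology (\<lambda>i::nat. euclideanreal) UNIV) hilbert_cube"
    unfolding hilbert_cube_def by (subst compactin_PiE) (auto simp: compactin_euclidean_iff)
  then show ?thesis
    by (simp add: euclidean_product_topology compactin_euclidean_iff)
qed

lemma continuous_on_coordinate: "continuous_on UNIV (\<lambda>p::nat\<Rightarrow>real. p i)"
  by simp

lemma tendsto_componentwise:
  fixes f :: "'c \<Rightarrow> nat \<Rightarrow> real"
  shows "(f \<longlongrightarrow> l) F \<longleftrightarrow> (\<forall>i. ((\<lambda>k. f k i) \<longlongrightarrow> l i) F)"
  using limitin_componentwise[of "\<lambda>i::nat. euclideanreal" UNIV f l F]
  by (simp add: euclidean_product_topology)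

text \<open>By compactness finitely many pairs would suffice, so only coordinates below some
  \<open>n\<close> matter. Kuhn's lemma on grids of mesh \<open>1 / P\<close> then yields small
  cells on which every label takes both values, and a limit of such cells lies outside all pairs
  with index below \<open>n\<close>.\<close>

lemma open_separated_pairs_not_cover_hilbert_cube:
  fixes A B :: "nat \<Rightarrow> (nat \<Rightarrow> real) set"
  assumes op: "\<And>i. open (A i)" "\<And>i. open (B i)"
    and disj: "\<And>i. A i \<inter> B i = {}"
    and A1: "\<And>i p. p \<in> A i \<Longrightarrow> p i < 1" and B0: "\<And>i p. p \<in> B i \<Longrightarrow> p i > 0"
  shows "\<not> hilbert_cube \<subseteq> (\<Union>i. A i \<union> B i)"
proof
  assume cov: "hilbert_cube \<subseteq> (\<Union>i. A i \<union> B i)"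
  obtain I where I: "finite I" "hilbert_cube \<subseteq> (\<Union>i\<in>I. A i \<union> B i)"
    using compactE_image[OF compact_hilbert_cube, of UNIV "\<lambda>i. A i \<union> B i"] cov op by (metis open_Un)
  obtain n where n: "I \<subseteq> {..<n}"
    using finite_nat_bounded I(1) by blast
  define pt where "pt P x = (\<lambda>i. if i < n then real (x i) / real P else 0)" for P :: nat and x :: "nat \<Rightarrow> nat"
  \<comment> \<open>Kuhn's boundary conditions are built in: \<open>x i = P\<close> forces label 1,
    while \<open>x i = 0\<close> gives label 0 because \<open>B i\<close> misses that face. Label 1
    still excludes \<open>A i\<close>, which misses the face \<open>p i = 1\<close>.\<close>
  define label :: "nat \<Rightarrow> (nat \<Rightarrow> nat) \<Rightarrow> nat \<Rightarrow> nat"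
    where "label P x i = (if pt P x \<in> B i \<or> x i = P then 1 else 0)" for P x i
  have pt_cube: "pt P x \<in> hilbert_cube" if "\<forall>i<n. x i \<le> P" for P x
    using that by (auto simp: pt_def mem_hilbert_cube divide_le_eq)
  have ex: "\<exists>q. (\<forall>i<n. q i < P) \<and> (\<forall>i<n. \<exists>r s. (\<forall>j<n. q j \<le> r j \<and> r j \<le> q j + 1) \<and>
      (\<forall>j<n. q j \<le> s j \<and> s j \<le> q j + 1) \<and> label P r i \<noteq> label P s i)" if "0 < P" for P
  proof -
    have 1: "\<forall>x. (\<forall>i<n. x i \<le> P) \<longrightarrow> (\<forall>i<n. label P x i = 0 \<or> label P x i = 1)"
      by (simp add: label_def)
    have "label P x i = 0" if "i < n" "x i = 0" for x i
    proof -
      have "pt P x i = 0" using that by (simp add: pt_def)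
      then have "pt P x \<notin> B i" using B0 by fastforce
      then show ?thesis using that \<open>0 < P\<close> by (simp add: label_def)
    qed
    then have 2: "\<forall>x. (\<forall>i<n. x i \<le> P) \<longrightarrow> (\<forall>i<n. x i = 0 \<longrightarrow> label P x i = 0)"
      by blast
    have 3: "\<forall>x. (\<forall>i<n. x i \<le> P) \<longrightarrow> (\<forall>i<n. x i = P \<longrightarrow> label P x i = 1)"
      by (simp add: label_def)
    show ?thesis
      using kuhn_lemma[OF that 1 2 3] by metis
  qed
  define good where "good P q \<longleftrightarrow> (\<forall>i<n. q i < P) \<and> (\<forall>i<n. \<exists>r s. (\<forall>j<n. q j \<le> r j \<and> r j \<le> q j + 1) \<and>
      (\<forall>j<n. q j \<le> s j \<and> s j \<le> q j + 1) \<and> label P r i \<noteq> label P s i)" for P q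
  have "\<forall>P. \<exists>q. good (Suc P) q"
    using ex unfolding good_def by blast
  then obtain q where q: "\<And>P. good (Suc P) (q P)"
    using choice[of "\<lambda>P. good (Suc P)"] by blast
  have qlt: "i < n \<Longrightarrow> q P i < Suc P" for P i
    using q[of P] unfolding good_def by blast
  have qrs: "\<exists>r s. (\<forall>j<n. q P j \<le> r j \<and> r j \<le> q P j + 1) \<and>
      (\<forall>j<n. q P j \<le> s j \<and> s j \<le> q P j + 1) \<and> pt (Suc P) r \<notin> A i \<and> pt (Suc P) s \<notin> B i" if i: "i < n" for P i
  proof -
    obtain r s where rs: "\<forall>j<n. q P j \<le> r j \<and> r j \<le> q P j + 1"
      "\<forall>j<n. q P j \<le> s j \<and> s j \<le> q P j + 1" "label (Suc P) r i \<noteq> label (Suc P) s i"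
      using q[of P] i unfolding good_def by blast
    have 1: "pt (Suc P) x \<notin> A i" if "label (Suc P) x i = 1" for x
    proof (cases "pt (Suc P) x \<in> B i")
      case False
      with that have "x i = Suc P" by (simp add: label_def split: if_splits)
      then have "pt (Suc P) x i = 1" using i by (simp add: pt_def)
      then show ?thesis using A1 by fastforce
    qed (use disj in blast)
    have 0: "pt (Suc P) x \<notin> B i" if "label (Suc P) x i = 0" for x
      using that by (simp add: label_def split: if_splits)
    have "label (Suc P) r i = 1 \<and> label (Suc P) s i = 0 \<or> label (Suc P) r i = 0 \<and> label (Suc P) s i = 1"
      using rs(3) by (simp add: label_def split: if_splits)
    then show ?thesis
    proof (elim disjE conjE)
      assume "label (Suc P) r i = 1" "label (Suc P) s i = 0"
      with rs 0 1 show ?thesis by (intro exI[of _ r] exI[of _ s]) simp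
    next
      assume "label (Suc P) r i = 0" "label (Suc P) s i = 1"
      with rs 0 1 show ?thesis by (intro exI[of _ s] exI[of _ r]) simp
    qed
  qed
  have "\<forall>P. pt (Suc P) (q P) \<in> hilbert_cube"
    by (intro allI pt_cube) (simp add: qlt less_imp_le)
  then obtain l \<sigma> where l: "l \<in> hilbert_cube" "strict_mono \<sigma>"
      "((\<lambda>P. pt (Suc P) (q P)) \<circ> \<sigma>) \<longlonglongrightarrow> l"
    using seq_compactE[OF compact_imp_seq_compact[OF compact_hilbert_cube],
        of "\<lambda>P. pt (Suc P) (q P)"] by blast
  have lc: "(\<lambda>k. pt (Suc (\<sigma> k)) (q (\<sigma> k)) j) \<longlonglongrightarrow> l j" for j
    using continuous_on_tendsto_compose[OF continuous_on_coordinate[of j] l(3)] by (simp add: o_def)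
  \<comment> \<open>Grid points picked from the cells converge to \<open>l\<close> along
    \<open>\<sigma>\<close> whatever the choice, since two points of one cell differ by at most
    \<open>1 / Suc P\<close> in each coordinate. If the choice can always avoid an open
    \<open>O'\<close>, then so does \<open>l\<close>.\<close>
  have lim: "l \<notin> O'" if i: "i < n" and O': "open O'"
    and x: "\<And>P. \<exists>x. (\<forall>j<n. q P j \<le> x j \<and> x j \<le> q P j + 1) \<and> pt (Suc P) x \<notin> O'" for i O'
  proof
    assume lO: "l \<in> O'"
    have "\<exists>x. \<forall>P. (\<forall>j<n. q P j \<le> x P j \<and> x P j \<le> q P j + 1) \<and> pt (Suc P) (x P) \<notin> O'"
      by (rule choice) (use x in blast)
    then obtain x where x: "\<And>P j. j < n \<Longrightarrow> q P j \<le> x P j \<and> x P j \<le> q P j + 1" "\<And>P. pt (Suc P) (x P) \<notin> O'"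
      by blast
    have "(\<lambda>k. pt (Suc (\<sigma> k)) (x (\<sigma> k)) j) \<longlonglongrightarrow> l j" for j
    proof -
      have b: "norm (pt (Suc P) (x P) j - pt (Suc P) (q P) j) \<le> inverse (real (Suc P))" for P
        using x(1)[of j P] 
        by (cases "j < n") (simp_all add: pt_def inverse_eq_divide divide_right_mono flip: diff_divide_distrib)
      have "(\<lambda>P. pt (Suc P) (x P) j - pt (Suc P) (q P) j) \<longlonglongrightarrow> 0"
        by (rule Lim_null_comparison[OF _ LIMSEQ_inverse_real_of_nat]) (use b in auto)
      then have "(\<lambda>k. pt (Suc (\<sigma> k)) (x (\<sigma> k)) j - pt (Suc (\<sigma> k)) (q (\<sigma> k)) j) \<longlonglongrightarrow> 0"
        using LIMSEQ_subseq_LIMSEQ[OF _ l(2)] by (force simp: o_def)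
      from tendsto_add[OF this lc[of j]] show ?thesis by simp
    qed
    then have "(\<lambda>k. pt (Suc (\<sigma> k)) (x (\<sigma> k))) \<longlonglongrightarrow> l"
      by (simp add: tendsto_componentwise)
    then have "\<forall>\<^sub>F k in sequentially. pt (Suc (\<sigma> k)) (x (\<sigma> k)) \<in> O'"
      using topological_tendstoD O' lO by blast
    then show False using x(2) by (auto simp: eventually_sequentially)
  qed
  have "l \<notin> A i \<union> B i" if "i < n" for i
    using lim[OF that op(1)] lim[OF that op(2)] qrs[OF that] by (metis Un_iff)
  then show False using I(2) l(1) n by blast
qed

definition cuttable :: "nat \<Rightarrow> (nat \<Rightarrow> real) set \<Rightarrow> bool" where
  "cuttable N Y \<longleftrightarrow> (\<forall>I. finite I \<and> card I = N \<longrightarrow>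
     (\<exists>A B. (\<forall>i\<in>I. open (A i) \<and> open (B i) \<and> A i \<inter> B i = {} \<and> A i \<subseteq> {p. p i < 1} \<and> B i \<subseteq> {p. 0 < p i}) \<and>
        Y \<subseteq> (\<Union>i\<in>I. A i \<union> B i)))"

lemma hilbert_cube_not_countable_Union_cuttable:
  assumes "\<And>n. \<exists>N. cuttable N (Y n)"
  shows "\<not> hilbert_cube \<subseteq> (\<Union>n::nat. Y n)"
proof
  assume cov: "hilbert_cube \<subseteq> (\<Union>n. Y n)"
  obtain N where N: "\<And>n. cuttable (N n) (Y n)" using assms by metis
  \<comment> \<open>The pairing function reserves a block of \<open>N n\<close> coordinates for
    \<open>Y n\<close>. The blocks are disjoint, so the pairs of open sets belonging to all
    \<open>n\<close> merge into one sequence; coordinates outside every block receive empty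
    sets.\<close>
  define I where "I n = (\<lambda>j. prod_encode (n, j)) ` {..<N n}" for n
  have I: "finite (I n) \<and> card (I n) = N n" for n
    by (auto simp: I_def card_image inj_on_def)
  have fstI: "fst (prod_decode i) = n" if "i \<in> I n" for i n
    using that by (auto simp: I_def)
  define good where "good n A B \<longleftrightarrow> (\<forall>i\<in>I n. open (A i) \<and> open (B i) \<and> A i \<inter> B i = {} \<and> A i \<subseteq> {p. p i < 1} \<and> B i \<subseteq> {p. 0 < p i}) \<and>
        Y n \<subseteq> (\<Union>i\<in>I n. A i \<union> B i)" for n A B
  have "\<forall>n. \<exists>A. \<exists>B. good n A B"
    using N I unfolding cuttable_def good_def by blast
  from choice[OF this] obtain A where "\<forall>n. \<exists>B. good n (A n) B" ..
  from choice[OF this] obtain B where "\<forall>n. good n (A n) (B n)" ..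
  then have AB: "\<And>n i. i \<in> I n \<Longrightarrow> open (A n i) \<and> open (B n i) \<and> A n i \<inter> B n i = {} \<and> A n i \<subseteq> {p. p i < 1} \<and> B n i \<subseteq> {p. 0 < p i}"
    and Y: "\<And>n. Y n \<subseteq> (\<Union>i\<in>I n. A n i \<union> B n i)" 
    unfolding good_def by blast+
  define A' where "A' i = (if \<exists>n. i \<in> I n then A (fst (prod_decode i)) i else {})" for i
  define B' where "B' i = (if \<exists>n. i \<in> I n then B (fst (prod_decode i)) i else {})" for i
  have "\<not> hilbert_cube \<subseteq> (\<Union>i. A' i \<union> B' i)"
    by (rule open_separated_pairs_not_cover_hilbert_cube) (use AB fstI in \<open>fastforce simp: A'_def B'_def split: if_splits\<close>)+
  moreover have "Y n \<subseteq> (\<Union>i. A' i \<union> B' i)" for n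
  proof -
    have "A n i = A' i \<and> B n i = B' i" if "i \<in> I n" for i
      using fstI[OF that] that by (auto simp: A'_def B'_def)
    then have "(\<Union>i\<in>I n. A n i \<union> B n i) \<subseteq> (\<Union>i. A' i \<union> B' i)"
      by (intro UN_mono) auto
    then show ?thesis using Y[of n] by (rule order_trans[rotated])
  qed
  then have "(\<Union>n. Y n) \<subseteq> (\<Union>i. A' i \<union> B' i)" by (rule UN_least)
  with cov have "hilbert_cube \<subseteq> (\<Union>i. A' i \<union> B' i)" by (rule order_trans)
  ultimately show False by (rule notE)
qed

subsection \<open>Covers of bounded order\<close>

text \<open>The order is bounded on all of \<open>Z\<close>, not just on \<open>S\<close>, because a
  family chosen for one fibre of a map is used over the neighbouring fibres too. \<open>N\<close>
  counts members, so it corresponds to dimension \<open>N - 1\<close>.\<close>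

definition covered_with_order :: "'a topology \<Rightarrow> 'a set set \<Rightarrow> nat \<Rightarrow> 'a set \<Rightarrow> bool" where
  "covered_with_order Z \<U> N S \<longleftrightarrow>
     (\<exists>\<G>. finite \<G> \<and> (\<forall>G\<in>\<G>. openin Z G \<and> (\<exists>U\<in>\<U>. G \<subseteq> U)) \<and> S \<subseteq> \<Union>\<G> \<and>
          (\<forall>z\<in>topspace Z. card {G\<in>\<G>. z \<in> G} \<le> N))"

text \<open>Pairwise disjoint neighbourhoods of the points, each cut down to a member of the cover,
  do the job. This is the starting case, applied to finite joint fibres.\<close>

lemma covered_with_order_finite:
  assumes "Hausdorff_space Z" "finite S" "S \<subseteq> topspace Z"
    and "\<And>U. U \<in> \<U> \<Longrightarrow> openin Z U" "\<Union>\<U> = topspace Z"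
  shows "covered_with_order Z \<U> 1 S"
proof -
  have "\<exists>T. \<forall>x\<in>S. openin Z (T x) \<and> x \<in> T x \<and> (\<forall>y\<in>S. x \<noteq> y \<longrightarrow> T x \<inter> T y = {})"
    using assms(2,3)
  proof (induction S)
    case empty then show ?case by simp
  next
    case (insert a S)
    then obtain T where T: "\<forall>x\<in>S. openin Z (T x) \<and> x \<in> T x \<and> (\<forall>y\<in>S. x \<noteq> y \<longrightarrow> T x \<inter> T y = {})"
      by auto
    have "compactin Z {a}" "compactin Z S" "disjnt {a} S"
      using insert by (auto simp: finite_imp_compactin)
    then obtain A B where AB: "openin Z A" "openin Z B" "{a} \<subseteq> A" "S \<subseteq> B" "disjnt A B"
      using assms(1) Hausdorff_space_compact_sets[of Z] by metis
    show ?case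
      by (rule exI[of _ "\<lambda>x. if x = a then A else T x \<inter> B"])
        (use T AB insert.hyps in \<open>auto simp: disjnt_def\<close>)
  qed
  then obtain T where T: "\<And>x. x \<in> S \<Longrightarrow> openin Z (T x) \<and> x \<in> T x"
    "\<And>x y. x \<in> S \<Longrightarrow> y \<in> S \<Longrightarrow> x \<noteq> y \<Longrightarrow> T x \<inter> T y = {}" by blast
  have "\<exists>u. \<forall>x\<in>S. u x \<in> \<U> \<and> x \<in> u x"
    by (rule bchoice) (use assms(3,5) in blast)
  then obtain u where u: "\<And>x. x \<in> S \<Longrightarrow> u x \<in> \<U> \<and> x \<in> u x" by blast
  let ?G = "\<lambda>x. T x \<inter> u x"
  have "card {G \<in> ?G ` S. z \<in> G} \<le> 1" for z
  proof -
    have "card {x \<in> S. z \<in> T x} \<le> Suc 0"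
      using card_le_Suc0_iff_eq[of "{x \<in> S. z \<in> T x}"] assms(2) T(2) by auto
    moreover have "card {G \<in> ?G ` S. z \<in> G} \<le> card {x \<in> S. z \<in> T x}"
      by (rule surj_card_le[where f = ?G]) (use assms(2) in auto)
    ultimately show ?thesis by simp
  qed
  moreover have "openin Z (?G x) \<and> (\<exists>U\<in>\<U>. ?G x \<subseteq> U)" if "x \<in> S" for x
    using T(1)[OF that] u[OF that] assms(4) by blast
  ultimately show ?thesis
    unfolding covered_with_order_def
    by (intro exI[of _ "?G ` S"]) (use assms(2) T(1) u in auto)
qed

lemma compact_space_pointwise_cover:
  assumes "compact_space X" and Q: "\<And>t. t \<in> topspace X \<Longrightarrow> openin X (Q t) \<and> t \<in> Q t"
  obtains T where "finite T" "T \<subseteq> topspace X" "topspace X \<subseteq> (\<Union>t\<in>T. Q t)"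
proof -
  have "Ball (Q ` topspace X) (openin X)" "topspace X \<subseteq> \<Union>(Q ` topspace X)"
    using Q by blast+
  with assms(1) obtain \<F> where F: "finite \<F>" "\<F> \<subseteq> Q ` topspace X" "topspace X \<subseteq> \<Union>\<F>"
    unfolding compact_space_alt by (elim allE[of _ "Q ` topspace X"]) auto
  from finite_subset_image[OF F(1,2)] obtain T where "T \<subseteq> topspace X" "finite T" "\<F> = Q ` T"
    by blast
  with F(3) show ?thesis using that by simp
qed

text \<open>Covering-dimension form of the Hurewicz estimate for closed maps, with the product
  of the orders in place of the sum of the dimensions.\<close>

lemma covered_with_order_fibres:
  assumes Z: "compact_space Z" and X: "compact_space X" "Hausdorff_space X" "covering_dim_le X n"
    and h: "continuous_map Z X h"
    and S: "closedin Z S"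
    and fib: "\<And>t. t \<in> topspace X \<Longrightarrow> covered_with_order Z \<U> N {z \<in> S. h z = t}"
  shows "covered_with_order Z \<U> ((n + 1) * N) S"
proof -
  define P where "P t \<G> \<longleftrightarrow> finite \<G> \<and> (\<forall>G\<in>\<G>. openin Z G \<and> (\<exists>U\<in>\<U>. G \<subseteq> U)) \<and> {z \<in> S. h z = t} \<subseteq> \<Union>\<G> \<and>
          (\<forall>z\<in>topspace Z. card {G\<in>\<G>. z \<in> G} \<le> N)" for t \<G>
  have "\<forall>t\<in>topspace X. \<exists>\<G>. P t \<G>"
    using fib by (simp add: covered_with_order_def P_def)
  from bchoice[OF this] obtain G where G: "\<And>t. t \<in> topspace X \<Longrightarrow> P t (G t)" by blast
  \<comment> \<open>Over \<open>Q t\<close> all of \<open>S\<close> lies inside the family chosen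
    for \<open>t\<close>. The set is open because images of compact sets are closed in the Hausdorff
    space \<open>X\<close>.\<close>
  define Q where "Q t = topspace X - h ` (S - \<Union>(G t))" for t
  have Qop: "openin X (Q t)" and tQ: "t \<in> Q t" if t: "t \<in> topspace X" for t
  proof -
    have "openin Z (\<Union>(G t))" using G[OF t] unfolding P_def by blast
    then have "closedin Z (S - \<Union>(G t))" using S by blast
    then have "compactin Z (S - \<Union>(G t))" using Z by (rule closedin_compact_space[rotated])
    then have "closedin X (h ` (S - \<Union>(G t)))"
      using compactin_imp_closedin[OF X(2) image_compactin[OF _ h]] by blast
    then show "openin X (Q t)" by (simp add: Q_def openin_diff)
    show "t \<in> Q t" using t G[OF t] by (auto simp: Q_def P_def)
  qed
  have QS: "z \<in> \<Union>(G t)" if "z \<in> S" "h z \<in> Q t" for z t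
    using that by (auto simp: Q_def)
  obtain T where T: "finite T" "T \<subseteq> topspace X" "topspace X \<subseteq> (\<Union>t\<in>T. Q t)"
    using compact_space_pointwise_cover[of X Q] X(1) Qop tQ by blast
  have "finite (Q ` T) \<and> (\<forall>U\<in>Q ` T. openin X U) \<and> \<Union>(Q ` T) = topspace X"
  proof (intro conjI ballI)
    have "Q t \<subseteq> topspace X" for t by (auto simp: Q_def)
    then show "\<Union>(Q ` T) = topspace X" using T(3) by blast
  qed (use T Qop in auto)
  then obtain \<W> where W: "finite \<W>" "\<forall>V\<in>\<W>. openin X V" "\<Union>\<W> = topspace X"
    "\<forall>V\<in>\<W>. \<exists>U\<in>Q ` T. V \<subseteq> U" "\<forall>x\<in>topspace X. card {V\<in>\<W>. x \<in> V} \<le> n + 1"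
    using X(3) unfolding covering_dim_le_def by (elim allE[of _ "Q ` T"]) auto
  have "\<forall>V\<in>\<W>. \<exists>t. t \<in> T \<and> V \<subseteq> Q t" using W(4) by blast
  from bchoice[OF this] obtain t where t: "\<And>V. V \<in> \<W> \<Longrightarrow> t V \<in> T \<and> V \<subseteq> Q (t V)" by blast
  have GW: "P (t V) (G (t V))" if "V \<in> \<W>" for V
    using G t[OF that] T(2) by blast
  \<comment> \<open>A point lies over at most \<open>n + 1\<close> members \<open>V\<close> of
    \<open>\<W>\<close>, and for each of them in at most \<open>N\<close> members of
    \<open>G (t V)\<close>; hence the product of the orders.\<close>
  define f where "f = (\<lambda>(V, G'). {z \<in> topspace Z. h z \<in> V} \<inter> G')"
  define I where "I = (SIGMA V:\<W>. G (t V))"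
  have finI: "finite I"
    unfolding I_def using W(1) GW by (auto simp: P_def)
  show ?thesis
    unfolding covered_with_order_def
  proof (intro exI[of _ "f ` I"] conjI ballI)
    show "finite (f ` I)" using finI by simp
    fix H assume "H \<in> f ` I"
    then obtain V G' where VG: "V \<in> \<W>" "G' \<in> G (t V)" "H = {z \<in> topspace Z. h z \<in> V} \<inter> G'"
      by (auto simp: I_def f_def)
    have G': "openin Z G'" "\<exists>U\<in>\<U>. G' \<subseteq> U" using GW[OF VG(1)] VG(2) by (auto simp: P_def)
    have "openin Z {z \<in> topspace Z. h z \<in> V}"
      using openin_continuous_map_preimage[OF h] W(2) VG(1) by blast
    then show "openin Z H" using VG(3) G'(1) by blast
    show "\<exists>U\<in>\<U>. H \<subseteq> U" using G'(2) VG(3) by blast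
  next
    show "S \<subseteq> \<Union>(f ` I)"
    proof
      fix z assume z: "z \<in> S"
      then have zZ: "z \<in> topspace Z" using S closedin_subset by blast
      then have "h z \<in> topspace X" using h by (simp add: continuous_map_def Pi_iff)
      then obtain V where V: "V \<in> \<W>" "h z \<in> V" using W(3) by blast
      then have "h z \<in> Q (t V)" using t by blast
      then obtain G' where G': "G' \<in> G (t V)" "z \<in> G'" using QS[OF z] by blast
      have "(V, G') \<in> I" "z \<in> f (V, G')" using V G' zZ by (auto simp: I_def f_def)
      then show "z \<in> \<Union>(f ` I)" by blast
    qed
  next
    fix z assume z: "z \<in> topspace Z"
    then have hz: "h z \<in> topspace X" using h by (simp add: continuous_map_def Pi_iff)
    let ?J = "SIGMA V:{V\<in>\<W>. h z \<in> V}. {G'\<in>G (t V). z \<in> G'}"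
    have finG: "finite (G (t V))" if "V \<in> \<W>" for V using GW[OF that] by (simp add: P_def)
    have "{H \<in> f ` I. z \<in> H} \<subseteq> f ` ?J"
      by (auto simp: f_def I_def)
    moreover have finJ: "finite ?J"
      using W(1) finG by (intro finite_SigmaI) auto
    ultimately have "card {H \<in> f ` I. z \<in> H} \<le> card ?J"
      using order_trans[OF card_mono[OF finite_imageI] card_image_le] by blast
    also have "\<dots> = (\<Sum>V\<in>{V\<in>\<W>. h z \<in> V}. card {G'\<in>G (t V). z \<in> G'})"
      using W(1) finG by (intro card_SigmaI) auto
    also have "\<dots> \<le> (\<Sum>V\<in>{V\<in>\<W>. h z \<in> V}. N)"
      using GW z by (intro sum_mono) (auto simp: P_def)
    also have "\<dots> = card {V\<in>\<W>. h z \<in> V} * N" by simp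
    also have "\<dots> \<le> (n + 1) * N"
      using W(5) hz by (intro mult_le_mono1) blast
    finally show "card {H \<in> f ` I. z \<in> H} \<le> (n + 1) * N" .
  qed
qed

text \<open>The maps are absorbed one at a time. Inside a joint fibre of the first \<open>m\<close>
  maps the fibre estimate for the next map multiplies \<open>N\<close> by its factor, and the
  induction hypothesis is applied with the larger \<open>N\<close>.\<close>

lemma covered_with_order_joint_fibres:
  fixes h :: "nat \<Rightarrow> 'z \<Rightarrow> 'x" and X :: "nat \<Rightarrow> 'x topology"
  assumes Z: "compact_space Z"
    and X: "\<And>j. j < m \<Longrightarrow> compact_space (X j) \<and> Hausdorff_space (X j) \<and> covering_dim_le (X j) (n j)"
    and h: "\<And>j. j < m \<Longrightarrow> continuous_map Z (X j) (h j)"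
    and S: "closedin Z S"
    and fib: "\<And>x. covered_with_order Z \<U> N {z \<in> S. \<forall>j<m. h j z = x j}"
  shows "covered_with_order Z \<U> ((\<Prod>j<m. n j + 1) * N) S"
  using X h fib
proof (induction m arbitrary: N)
  case 0 then show ?case using "0.prems"(3) by simp
next
  case (Suc m)
  have "covered_with_order Z \<U> ((n m + 1) * N) {z \<in> S. \<forall>j<m. h j z = x j}" for x
  \<comment> \<open>Points of the Hausdorff spaces are closed, which makes the joint fibre closed;
    if some \<open>x j\<close> is outside its space, the joint fibre is empty.\<close>
  proof (cases "\<forall>j<m. x j \<in> topspace (X j)")
    case True
    show ?thesis
    proof (rule covered_with_order_fibres[where X = "X m" and h = "h m"])
      show "covered_with_order Z \<U> N {z \<in> {z \<in> S. \<forall>j<m. h j z = x j}. h m z = t}" for t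
      proof -
        have "{z \<in> {z \<in> S. \<forall>j<m. h j z = x j}. h m z = t} = {z \<in> S. \<forall>j<Suc m. h j z = (x(m := t)) j}"
          by (auto simp: less_Suc_eq)
        then show ?thesis by (simp only: Suc.prems(3))
      qed
      have "closedin Z {z \<in> topspace Z. h j z \<in> {x j}}" if "j < m" for j
        by (rule closedin_continuous_map_preimage[of _ "X j"])
          (use that Suc.prems True in \<open>auto simp: closedin_Hausdorff_singleton\<close>)
      then have "closedin Z (S \<inter> (\<Inter>j\<in>{..<m}. {z \<in> topspace Z. h j z \<in> {x j}}))" if "m \<noteq> 0"
        using S that by (intro closedin_Int closedin_INT) auto
      moreover have "S \<inter> (\<Inter>j\<in>{..<m}. {z \<in> topspace Z. h j z \<in> {x j}}) = {z \<in> S. \<forall>j<m. h j z = x j}"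
        if "m \<noteq> 0"
        using closedin_subset[OF S] by auto
      ultimately show "closedin Z {z \<in> S. \<forall>j<m. h j z = x j}"
        using S by (cases "m = 0") simp_all
    qed (use Suc.prems Z in auto)
  next
    case False
    then obtain j where j: "j < m" "x j \<notin> topspace (X j)" by blast
    have "h j z \<in> topspace (X j)" if "z \<in> S" for z
      using Suc.prems(2)[of j] j(1) closedin_subset[OF S] that by (auto simp: continuous_map_def Pi_iff)
    with j have "{z \<in> S. \<forall>j<m. h j z = x j} = {}"
      by fastforce
    then show ?thesis
      unfolding covered_with_order_def by (intro exI[of _ "{}"]) auto
  qed
  then have "covered_with_order Z \<U> ((\<Prod>j<m. n j + 1) * ((n m + 1) * N)) S"
    using Suc.prems by (intro Suc.IH) auto
  then show ?case by (simp only: prod.lessThan_Suc mult.assoc)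
qed

section \<open>Maps into the cube with fibres of bounded size\<close>

lemma closed_shrinking:
  assumes Z: "compact_space Z" "Hausdorff_space Z" and fin: "finite \<G>"
    and G: "\<And>G. G \<in> \<G> \<Longrightarrow> openin Z G" "topspace Z \<subseteq> \<Union>\<G>"
  obtains D where "\<And>G. G \<in> \<G> \<Longrightarrow> closedin Z (D G) \<and> D G \<subseteq> G" "topspace Z = (\<Union>G\<in>\<G>. D G)"
proof -
  have "\<exists>V C G. openin Z V \<and> closedin Z C \<and> z \<in> V \<and> V \<subseteq> C \<and> C \<subseteq> G \<and> G \<in> \<G>" if z: "z \<in> topspace Z" for z
  proof -
    obtain G where GG: "G \<in> \<G>" "z \<in> G" using z G(2) by blast
    have "neighbourhood_base_of (closedin Z) Z"
      using Z compact_Hausdorff_imp_regular_space neighbourhood_base_of_closedin by blast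
    from this[unfolded neighbourhood_base_of, rule_format, of G z] obtain V C
      where "openin Z V \<and> closedin Z C \<and> z \<in> V \<and> V \<subseteq> C \<and> C \<subseteq> G"
      using G(1)[OF GG(1)] GG(2) by blast
    with GG(1) show ?thesis by (intro exI[of _ V] exI[of _ C] exI[of _ G]) simp
  qed
  then have "\<forall>z\<in>topspace Z. \<exists>VCG. openin Z (fst VCG) \<and> closedin Z (fst (snd VCG)) \<and> z \<in> fst VCG \<and>
      fst VCG \<subseteq> fst (snd VCG) \<and> fst (snd VCG) \<subseteq> snd (snd VCG) \<and> snd (snd VCG) \<in> \<G>"
    by (simp add: split_paired_Ex)
  from bchoice[OF this] obtain f where f: "\<And>z. z \<in> topspace Z \<Longrightarrow> openin Z (fst (f z)) \<and> closedin Z (fst (snd (f z))) \<and> z \<in> fst (f z) \<and>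
      fst (f z) \<subseteq> fst (snd (f z)) \<and> fst (snd (f z)) \<subseteq> snd (snd (f z)) \<and> snd (snd (f z)) \<in> \<G>"
    by blast
  obtain T where T: "finite T" "T \<subseteq> topspace Z" "topspace Z \<subseteq> (\<Union>t\<in>T. fst (f t))"
    using compact_space_pointwise_cover[of Z "\<lambda>z. fst (f z)"] Z(1) f by blast
  \<comment> \<open>By regularity each point has a closed neighbourhood inside some member of the
    cover. Finitely many of these suffice, and \<open>D G\<close> collects those assigned to
    \<open>G\<close>.\<close>
  define D where "D G = (\<Union>t\<in>{t\<in>T. snd (snd (f t)) = G}. fst (snd (f t)))" for G
  show ?thesis
  proof (rule that)
    show D: "closedin Z (D G) \<and> D G \<subseteq> G" for G
      unfolding D_def using T f by (intro conjI closedin_Union) auto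
    show "topspace Z = (\<Union>G\<in>\<G>. D G)"
    proof
      show "(\<Union>G\<in>\<G>. D G) \<subseteq> topspace Z" using D closedin_subset by blast
      show "topspace Z \<subseteq> (\<Union>G\<in>\<G>. D G)"
      proof
        fix z assume "z \<in> topspace Z"
        then obtain t where t: "t \<in> T" "z \<in> fst (f t)" using T(3) by blast
        then have "z \<in> fst (snd (f t))" "snd (snd (f t)) \<in> \<G>" using f T(2) by blast+
        then show "z \<in> (\<Union>G\<in>\<G>. D G)" using t unfolding D_def by blast
      qed
    qed
  qed
qed

text \<open>The sets \<open>U J\<close> cover the cube; \<open>J\<close> records which of the two
  opposite faces is avoided in each direction of \<open>I\<close>. A refinement of order
  \<open>N\<close> of their preimages is shrunk to closed sets, whose images are compact. A point of
  \<open>Y\<close> lies in at least one and at most \<open>r * N\<close> images, as each of its at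
  most \<open>r\<close> preimages lies in at most \<open>N\<close> members. Points in the same
  number of images are sorted into disjoint open sets by comparing distances, so one coordinate can
  serve each number.\<close>

lemma cuttable_bounded_fibres:
  fixes f :: "'z \<Rightarrow> nat \<Rightarrow> real"
  assumes Z: "compact_space Z" "Hausdorff_space Z" and f: "continuous_map Z euclidean f"
    and ord: "\<And>\<U>. (\<forall>U\<in>\<U>. openin Z U) \<Longrightarrow> \<Union>\<U> = topspace Z \<Longrightarrow> covered_with_order Z \<U> N (topspace Z)"
    and Y: "\<And>p. p \<in> Y \<Longrightarrow> finite {z \<in> topspace Z. f z = p} \<and> {z \<in> topspace Z. f z = p} \<noteq> {} \<and>
      card {z \<in> topspace Z. f z = p} \<le> r"
  shows "cuttable (r * N) Y"
  unfolding cuttable_def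
proof (intro allI impI, elim conjE)
  fix I :: "nat set" assume I: "finite I" "card I = r * N"
  define U where "U J = {p::nat\<Rightarrow>real. \<forall>i\<in>I. if i \<in> J then 0 < p i else p i < 1}" for J
  have Uopen: "open (U J)" for J
  proof -
    have "U J = (\<Inter>i\<in>I. if i \<in> J then {p. 0 < p i} else {p. p i < 1})"
      by (auto simp: U_def split: if_splits)
    moreover have "open {p::nat\<Rightarrow>real. 0 < p i}" "open {p::nat\<Rightarrow>real. p i < 1}" for i
      by (intro open_Collect_less continuous_on_const continuous_on_coordinate)+
    ultimately show ?thesis using I(1) by (auto intro!: open_INT)
  qed
  define \<U> where "\<U> = range (\<lambda>J. {z \<in> topspace Z. f z \<in> U J})"
  have "\<forall>W\<in>\<U>. openin Z W"
  proof
    fix W assume "W \<in> \<U>"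
    then obtain J where W: "W = {z \<in> topspace Z. f z \<in> U J}" by (auto simp: \<U>_def)
    have "openin euclidean (U J)" using Uopen by simp
    then show "openin Z W" unfolding W by (rule openin_continuous_map_preimage[OF f])
  qed
  moreover have "\<Union>\<U> = topspace Z"
  proof
    show "topspace Z \<subseteq> \<Union>\<U>"
    proof
      fix z assume "z \<in> topspace Z"
      moreover have "f z \<in> U {i. 0 < f z i}" by (auto simp: U_def)
      ultimately show "z \<in> \<Union>\<U>" unfolding \<U>_def by blast
    qed
  qed (auto simp: \<U>_def)
  ultimately have "covered_with_order Z \<U> N (topspace Z)" by (rule ord)
  then obtain \<G> where "finite \<G> \<and> (\<forall>G\<in>\<G>. openin Z G \<and> (\<exists>W\<in>\<U>. G \<subseteq> W)) \<and> topspace Z \<subseteq> \<Union>\<G> \<and>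
          (\<forall>z\<in>topspace Z. card {G\<in>\<G>. z \<in> G} \<le> N)"
    unfolding covered_with_order_def ..
  then have G: "finite \<G>" "\<And>G. G \<in> \<G> \<Longrightarrow> openin Z G" "\<And>G. G \<in> \<G> \<Longrightarrow> \<exists>W\<in>\<U>. G \<subseteq> W"
    "topspace Z \<subseteq> \<Union>\<G>" "\<And>z. z \<in> topspace Z \<Longrightarrow> card {G\<in>\<G>. z \<in> G} \<le> N"
    by simp_all
  obtain D where D: "\<And>G. G \<in> \<G> \<Longrightarrow> closedin Z (D G) \<and> D G \<subseteq> G" "topspace Z = (\<Union>G\<in>\<G>. D G)"
    using closed_shrinking[OF Z G(1) G(2) G(4)] by blast
  have "\<forall>G\<in>\<G>. \<exists>J. \<forall>z\<in>G. f z \<in> U J"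
  proof
    fix G assume "G \<in> \<G>"
    then obtain W where "W \<in> \<U>" "G \<subseteq> W" using G(3) by blast
    then obtain J where "G \<subseteq> {z \<in> topspace Z. f z \<in> U J}" by (auto simp: \<U>_def)
    then show "\<exists>J. \<forall>z\<in>G. f z \<in> U J" by blast
  qed
  from bchoice[OF this] obtain J where J: "\<And>G z. G \<in> \<G> \<Longrightarrow> z \<in> G \<Longrightarrow> f z \<in> U (J G)" by blast
  define C where "C G = f ` D G" for G
  \<comment> \<open>Empty pieces are dropped because \<open>infdist p {} = 0\<close>.\<close>
  define \<H> where "\<H> = {G \<in> \<G>. D G \<noteq> {}}"
  have H: "finite \<H>" "\<H> \<subseteq> \<G>" using G(1) by (auto simp: \<H>_def)
  have C: "closed (C G) \<and> C G \<noteq> {}" if "G \<in> \<H>" for G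
  proof -
    have "compactin Z (D G)"
      using that D(1) Z(1) closedin_compact_space by (auto simp: \<H>_def)
    then have "compactin euclidean (C G)"
      unfolding C_def using f by (rule image_compactin)
    then show ?thesis using that by (auto simp: \<H>_def C_def compact_imp_closed)
  qed
  \<comment> \<open>For a fixed size of \<open>S\<close> these sets are pairwise disjoint, and \<open>p\<close> lies in
    \<open>V {G \<in> \<H>. p \<in> C G}\<close>; on \<open>Y\<close> the size of that index set is at most \<open>r * N\<close>.\<close>
  define V where "V S = {p. \<forall>s\<in>S. \<forall>t\<in>\<H> - S. infdist p (C s) < infdist p (C t)}" for S
  have Vopen: "open (V S)" if "S \<subseteq> \<H>" for S
  proof -
    have "V S = (\<Inter>s\<in>S. \<Inter>t\<in>\<H> - S. {p. infdist p (C s) < infdist p (C t)})"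
      by (auto simp: V_def)
    moreover have "finite S" using that H(1) finite_subset by blast
    moreover have "open {p. infdist p (C s) < infdist p (C t)}" for s t
      by (intro open_Collect_less continuous_on_infdist continuous_on_id)
    ultimately show ?thesis using H(1) by (auto intro!: open_INT)
  qed
  define \<sigma> where "\<sigma> S = (SOME s. s \<in> S)" for S :: "'z set set"
  have \<sigma>: "\<sigma> S \<in> S" if "S \<noteq> {}" for S
    using that unfolding \<sigma>_def by (simp add: some_in_eq)
  \<comment> \<open>One chosen member \<open>\<sigma> S\<close> decides, through its face pattern
    \<open>J\<close>, on which side the whole of \<open>V' S\<close> goes. A point \<open>p\<close>
    of \<open>Y\<close> survives this intersection for its own index set \<open>T\<close>, because
    it lies in \<open>C (\<sigma> T)\<close>.\<close>
  define V' where "V' S = V S \<inter> U (J (\<sigma> S))" for S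
  \<comment> \<open>Coordinate \<open>i\<close> serves the index sets of size
    \<open>h i + 1\<close>, so the sizes from 1 to \<open>r * N\<close> are used once each.\<close>
  obtain h where h: "bij_betw h I {0..<r * N}"
    using ex_bij_betw_finite_nat[OF I(1)] I(2) by auto
  define \<A> where "\<A> i = {S. S \<subseteq> \<H> \<and> S \<noteq> {} \<and> card S = Suc (h i) \<and> i \<notin> J (\<sigma> S)}" for i
  define \<B> where "\<B> i = {S. S \<subseteq> \<H> \<and> S \<noteq> {} \<and> card S = Suc (h i) \<and> i \<in> J (\<sigma> S)}" for i
  define A where "A i = \<Union>(V' ` \<A> i)" for i
  define B where "B i = \<Union>(V' ` \<B> i)" for i
  have disj: "A i \<inter> B i = {}" for i
  proof (rule ccontr)
    assume "A i \<inter> B i \<noteq> {}"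
    then obtain p where "p \<in> A i" "p \<in> B i" by blast
    then obtain S S' where SS: "S \<in> \<A> i" "S' \<in> \<B> i" "p \<in> V S" "p \<in> V S'"
      unfolding A_def B_def V'_def by blast
    then have ne: "S \<noteq> S'" by (auto simp: \<A>_def \<B>_def)
    have cd: "card S = card S'" and sub: "S \<subseteq> \<H>" "S' \<subseteq> \<H>" using SS by (auto simp: \<A>_def \<B>_def)
    have fin: "finite S" "finite S'" using sub H(1) finite_subset by blast+
    \<comment> \<open>Distinct finite sets of equal size each have a member outside the other, and
      this forces two contradictory strict inequalities between distances.\<close>
    obtain s where s: "s \<in> S" "s \<notin> S'" using card_subset_eq[OF fin(2), of S] cd ne by blast
    obtain s' where s': "s' \<in> S'" "s' \<notin> S" using card_subset_eq[OF fin(1), of S'] cd ne by auto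
    have "infdist p (C s) < infdist p (C s')" "infdist p (C s') < infdist p (C s)"
      using SS(3,4) s s' sub unfolding V_def by blast+
    then show False by simp
  qed
  have Y': "p \<in> (\<Union>i\<in>I. A i \<union> B i)" if p: "p \<in> Y" for p
  proof -
    let ?F = "{z \<in> topspace Z. f z = p}"
    define T where "T = {G \<in> \<H>. p \<in> C G}"
    have "T \<subseteq> (\<Union>z\<in>?F. {G\<in>\<G>. z \<in> G})"
    proof
      fix G assume "G \<in> T"
      then have "G \<in> \<G>" "p \<in> C G" using H(2) by (auto simp: T_def)
      then obtain z where "z \<in> D G" "f z = p" by (auto simp: C_def)
      then show "G \<in> (\<Union>z\<in>?F. {G\<in>\<G>. z \<in> G})"
        using D(1)[OF \<open>G \<in> \<G>\<close>] closedin_subset \<open>G \<in> \<G>\<close> by blast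
    qed
    then have "card T \<le> card (\<Union>z\<in>?F. {G\<in>\<G>. z \<in> G})"
      using Y[OF p] G(1) by (intro card_mono) auto
    also have "\<dots> \<le> (\<Sum>z\<in>?F. card {G\<in>\<G>. z \<in> G})"
      using Y[OF p] by (intro card_UN_le) auto
    also have "\<dots> \<le> (\<Sum>z\<in>?F. N)"
      using G(5) by (intro sum_mono) auto
    also have "\<dots> \<le> r * N" using Y[OF p] by simp
    finally have cT: "card T \<le> r * N" .
    have TH: "T \<subseteq> \<H>" "finite T" using H(1) by (auto simp: T_def)
    obtain z where z: "z \<in> topspace Z" "f z = p" using Y[OF p] by blast
    then obtain G0 where "G0 \<in> \<G>" "z \<in> D G0" using D(2) by blast
    then have "G0 \<in> T" using z by (auto simp: T_def \<H>_def C_def)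
    then have Tne: "T \<noteq> {}" by blast
    then have "card T \<noteq> 0" using TH by simp
    then have "card T - 1 \<in> {0..<r * N}" using cT by auto
    then obtain i where i: "i \<in> I" "h i = card T - 1"
      using h unfolding bij_betw_def by (metis imageE)
    have hi: "card T = Suc (h i)" using i(2) \<open>card T \<noteq> 0\<close> by simp
    have "infdist p (C s) < infdist p (C t)" if s: "s \<in> T" and t: "t \<in> \<H> - T" for s t
    proof -
      have "infdist p (C s) = 0" using s by (simp add: T_def)
      moreover have "p \<notin> C t" using t by (auto simp: T_def)
      then have "infdist p (C t) > 0" using C t infdist_pos_not_in_closed[of "C t" p] by auto
      ultimately show ?thesis by simp
    qed
    then have "p \<in> V T" unfolding V_def by blast
    moreover have "p \<in> U (J (\<sigma> T))"
    proof -
      have "\<sigma> T \<in> T" using \<sigma>[OF Tne] .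
      then have s: "\<sigma> T \<in> \<G>" "p \<in> C (\<sigma> T)" using H(2) by (auto simp: T_def)
      then obtain z where "z \<in> D (\<sigma> T)" "f z = p" by (auto simp: C_def)
      then show ?thesis using J[OF s(1), of z] D(1)[OF s(1)] by blast
    qed
    ultimately have pV: "p \<in> V' T" by (simp add: V'_def)
    have "T \<in> \<A> i \<or> T \<in> \<B> i" using TH(1) Tne hi by (simp add: \<A>_def \<B>_def)
    then have "p \<in> A i \<union> B i" using pV unfolding A_def B_def by blast
    then show ?thesis using i(1) by blast
  qed
  have AB: "open (A i) \<and> open (B i) \<and> A i \<inter> B i = {} \<and> A i \<subseteq> {p. p i < 1} \<and> B i \<subseteq> {p. 0 < p i}" if i: "i \<in> I" for i
  proof (intro conjI)
    show "open (A i)" unfolding A_def V'_def \<A>_def using Vopen Uopen by (intro open_UN) auto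
    show "open (B i)" unfolding B_def V'_def \<B>_def using Vopen Uopen by (intro open_UN) auto
    have "U J' \<subseteq> {p. p i < 1}" if "i \<notin> J'" for J' using i that by (auto simp: U_def)
    then show "A i \<subseteq> {p. p i < 1}" unfolding A_def V'_def \<A>_def by blast
    have "U J' \<subseteq> {p. 0 < p i}" if "i \<in> J'" for J' using i that by (auto simp: U_def)
    then show "B i \<subseteq> {p. 0 < p i}" unfolding B_def V'_def \<B>_def by blast
    show "A i \<inter> B i = {}" by (rule disj)
  qed
  show "\<exists>A B. (\<forall>i\<in>I. open (A i) \<and> open (B i) \<and> A i \<inter> B i = {} \<and> A i \<subseteq> {p. p i < 1} \<and> B i \<subseteq> {p. 0 < p i}) \<and>
        Y \<subseteq> (\<Union>i\<in>I. A i \<union> B i)"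
    by (intro exI[of _ A] exI[of _ B] conjI ballI AB subsetI Y')
qed

subsection \<open>Functionals on C(M)\<close>

text \<open>Gaussian elimination, by induction on the equations: one with a nonzero coefficient at
  \<open>k\<close> is solved for the unknown \<open>k\<close> and substituted into the others,
  giving the system \<open>b\<close>.\<close>

lemma homogeneous_system_nontrivial_solution:
  fixes a :: "'j \<Rightarrow> 'i \<Rightarrow> 'f::field"
  assumes "finite J" "finite I" "card J < card I"
  shows "\<exists>c. (\<exists>i\<in>I. c i \<noteq> 0) \<and> (\<forall>j\<in>J. (\<Sum>i\<in>I. c i * a j i) = 0)"
  using assms
proof (induction J arbitrary: I a rule: finite_induct)
  case empty
  then have "I \<noteq> {}" by auto
  then show ?case by (intro exI[of _ "\<lambda>_. 1"]) auto
next
  case (insert j J)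
  show ?case
  proof (cases "\<forall>i\<in>I. a j i = 0")
    case True
    have "card J < card I" using insert by auto
    then obtain c where "\<exists>i\<in>I. c i \<noteq> 0" "\<forall>j\<in>J. (\<Sum>i\<in>I. c i * a j i) = 0"
      using insert.IH[OF insert.prems(1), of a] by blast
    with True show ?thesis by (intro exI[of _ c]) auto
  next
    case False
    then obtain k where k: "k \<in> I" "a j k \<noteq> 0" by blast
    define b where "b j' i = a j' i - a j' k * (a j i / a j k)" for j' i
    have "card J < card (I - {k})" using insert k by simp
    then obtain c where c: "\<exists>i\<in>I - {k}. c i \<noteq> 0" "\<forall>j'\<in>J. (\<Sum>i\<in>I - {k}. c i * b j' i) = 0"
      using insert.IH[of "I - {k}" b] insert.prems(1) by auto
    \<comment> \<open>The value at \<open>k\<close> is the one that the eliminated equation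
      prescribes.\<close>
    define c' where "c' i = (if i = k then - (\<Sum>i\<in>I - {k}. c i * (a j i / a j k)) else c i)" for i
    have sum: "(\<Sum>i\<in>I. c' i * a j' i) = (\<Sum>i\<in>I - {k}. c i * b j' i)" for j'
    proof -
      have "(\<Sum>i\<in>I. c' i * a j' i) = c' k * a j' k + (\<Sum>i\<in>I - {k}. c' i * a j' i)"
        using k(1) insert.prems(1) by (rule sum.remove[rotated])
      also have "(\<Sum>i\<in>I - {k}. c' i * a j' i) = (\<Sum>i\<in>I - {k}. c i * a j' i)"
        by (intro sum.cong) (auto simp: c'_def)
      also have "c' k * a j' k = - (\<Sum>i\<in>I - {k}. c i * (a j' k * (a j i / a j k)))"
        by (simp add: c'_def sum_distrib_left sum_distrib_right mult_ac)
      finally show ?thesis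
        by (simp add: b_def algebra_simps sum_subtractf)
    qed
    have "(\<Sum>i\<in>I. c' i * a j i) = 0"
      unfolding sum using k(2) by (simp add: b_def)
    moreover have "\<exists>i\<in>I. c' i \<noteq> 0" using c(1) by (auto simp: c'_def)
    ultimately show ?thesis using c(2) sum by (intro exI[of _ c']) auto
  qed
qed

lemma CK_add_scale:
  assumes "compact_space K" "f \<in> CK K" "g \<in> CK K"
  shows "(\<lambda>x\<in>topspace K. f x + c * g x) \<in> CK K"
  using assms
  by (auto simp: CK_compact intro!: continuous_map_eq[where f = "\<lambda>x. f x + c * g x"]
      continuous_map_add continuous_map_real_mult_left)

lemma CK_scale:
  assumes "compact_space K" "g \<in> CK K"
  shows "(\<lambda>x\<in>topspace K. c * g x) \<in> CK K"
  using assms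
  by (auto simp: CK_compact intro!: continuous_map_eq[where f = "\<lambda>x. c * g x"] continuous_map_real_mult_left)

lemma CK_zero: "compact_space K \<Longrightarrow> (\<lambda>x\<in>topspace K. 0) \<in> CK K"
  by (auto simp: CK_compact intro!: continuous_map_eq[where f = "\<lambda>x. 0"])

lemma CK_dual_add_scale:
  assumes "compact_space K" "\<nu> \<in> CK_dual K" "f \<in> CK K" "g \<in> CK K"
  shows "\<nu> (\<lambda>x\<in>topspace K. f x + c * g x) = \<nu> f + c * \<nu> g"
proof -
  have "\<nu> (\<lambda>x\<in>topspace K. f x + (\<lambda>x\<in>topspace K. c * g x) x) = \<nu> f + c * \<nu> g"
  proof -
    have "\<nu> (\<lambda>x\<in>topspace K. f x + h x) = \<nu> f + \<nu> h" if "h \<in> CK K" for h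
      using assms(2,3) that by (simp add: CK_dual_def)
    from this[OF CK_scale[OF assms(1,4)]] show ?thesis
      using assms(2,4) unfolding CK_dual_def by simp
  qed
  moreover have "(\<lambda>x\<in>topspace K. f x + (\<lambda>x\<in>topspace K. c * g x) x) = (\<lambda>x\<in>topspace K. f x + c * g x)"
    by (auto simp: restrict_def)
  ultimately show ?thesis by simp
qed

lemma CK_dual_scale:
  assumes "\<nu> \<in> CK_dual K" "g \<in> CK K"
  shows "\<nu> (\<lambda>x\<in>topspace K. c * g x) = c * \<nu> g"
  using assms by (simp add: CK_dual_def)

lemma CK_dual_zero:
  assumes "compact_space K" "\<nu> \<in> CK_dual K"
  shows "\<nu> (\<lambda>x\<in>topspace K. 0) = 0"
  using CK_dual_scale[OF assms(2) CK_zero[OF assms(1)], of 0] by simp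

lemma CK_dual_sum:
  assumes K: "compact_space K" and "finite P" "\<And>q. q \<in> P \<Longrightarrow> g q \<in> CK K"
  shows "(\<lambda>x\<in>topspace K. \<Sum>q\<in>P. c q * g q x) \<in> CK K \<and>
    (\<forall>\<nu>\<in>CK_dual K. \<nu> (\<lambda>x\<in>topspace K. \<Sum>q\<in>P. c q * g q x) = (\<Sum>q\<in>P. c q * \<nu> (g q)))"
  using assms(2,3)
proof (induction P rule: finite_induct)
  case empty
  show ?case using CK_zero[OF K] CK_dual_zero[OF K] by (simp only: sum.empty) blast
next
  case (insert q P)
  let ?s = "\<lambda>x\<in>topspace K. \<Sum>q\<in>P. c q * g q x"
  have s: "?s \<in> CK K" "\<forall>\<nu>\<in>CK_dual K. \<nu> ?s = (\<Sum>q\<in>P. c q * \<nu> (g q))"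
    using insert.IH insert.prems by blast+
  have gq: "g q \<in> CK K" using insert by simp
  have "(\<lambda>x\<in>topspace K. ?s x + c q * g q x) = (\<lambda>x\<in>topspace K. \<Sum>q\<in>insert q P. c q * g q x)"
    using insert.hyps by (auto simp: restrict_def add.commute)
  from CK_add_scale[OF K s(1) gq, of "c q", unfolded this]
    CK_dual_add_scale[OF K _ s(1) gq, of _ "c q", unfolded this]
  have A: "(\<lambda>x\<in>topspace K. \<Sum>q\<in>insert q P. c q * g q x) \<in> CK K"
    "\<And>\<nu>. \<nu> \<in> CK_dual K \<Longrightarrow> \<nu> (\<lambda>x\<in>topspace K. \<Sum>q\<in>insert q P. c q * g q x) = \<nu> ?s + c q * \<nu> (g q)"
    by blast+
  show ?case
  proof (intro conjI ballI)
    fix \<nu> assume \<nu>: "\<nu> \<in> CK_dual K"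
    then have "\<nu> ?s = (\<Sum>q\<in>P. c q * \<nu> (g q))" using s(2) by blast
    with A(2)[OF \<nu>]
    show "\<nu> (\<lambda>x\<in>topspace K. \<Sum>q\<in>insert q P. c q * g q x) = (\<Sum>q\<in>insert q P. c q * \<nu> (g q))"
      by (simp only: sum.insert[OF insert.hyps] add.commute)
  qed (rule A(1))
qed

section \<open>A Hilbert cube of independent functionals\<close>

definition monom_at :: "nat \<Rightarrow> (nat \<Rightarrow> real) \<Rightarrow> real" where
  "monom_at n p = prod_list (map p (from_nat n))"

lemma monom_at_bounds:
  assumes "p \<in> hilbert_cube"
  shows "0 \<le> monom_at n p" "monom_at n p \<le> 1"
proof -
  have "0 \<le> prod_list (map p l) \<and> prod_list (map p l) \<le> 1" for l
    using assms by (induction l) (auto simp: mem_hilbert_cube intro: mult_le_one)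
  then show "0 \<le> monom_at n p" "monom_at n p \<le> 1" by (auto simp: monom_at_def)
qed

lemma continuous_on_monom_at: "continuous_on A (monom_at n)"
proof -
  have "continuous_on A (\<lambda>p::nat\<Rightarrow>real. prod_list (map p l))" for l
    by (induction l) (auto intro!: continuous_intros continuous_on_subset[OF continuous_on_coordinate])
  then show ?thesis by (simp add: monom_at_def[abs_def])
qed

text \<open>The functional \<open>\<Sum>n. 2\<^sup>-\<^sup>n m\<^sub>n(p) \<delta>\<^bsub>x n\<^esub>\<close>, where \<open>m\<^sub>0, m\<^sub>1, \<dots>\<close> lists all monomials in the
  coordinates of \<open>p\<close>. Polynomials separate finitely many points, which makes these functionals
  linearly independent when the points \<open>x n\<close> are isolated from each other.\<close>

definition monom_series :: "(nat \<Rightarrow> 'm) \<Rightarrow> (nat \<Rightarrow> real) \<Rightarrow> ('m \<Rightarrow> real) \<Rightarrow> real" where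
  "monom_series x p g = (\<Sum>n. (1/2) ^ n * monom_at n p * g (x n))"

lemma CK_bounded:
  assumes "compact_space K" "g \<in> CK K"
  obtains B where "\<And>x. x \<in> topspace K \<Longrightarrow> \<bar>g x\<bar> \<le> B"
proof -
  have "compactin euclideanreal (g ` topspace K)"
    using assms image_compactin[of K "topspace K" euclideanreal g] by (simp add: CK_compact compact_space_def)
  then have "bounded (g ` topspace K)" by (simp add: compact_imp_bounded)
  then show ?thesis using that by (auto simp: bounded_iff)
qed

lemma monom_series_term_bound:
  assumes "p \<in> hilbert_cube" "\<bar>y\<bar> \<le> B"
  shows "norm ((1/2) ^ n * monom_at n p * y) \<le> (1/2) ^ n * B"
proof -
  have "monom_at n p * \<bar>y\<bar> \<le> 1 * B"
    using monom_at_bounds[OF assms(1), of n] assms(2) by (intro mult_mono) auto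
  then show ?thesis
    using monom_at_bounds(1)[OF assms(1), of n] by (simp add: abs_mult mult.assoc)
qed

lemma summable_geometric_half_mult: "summable (\<lambda>n. (1/2) ^ n * (B::real))"
  by (intro summable_mult2 summable_geometric) simp

lemma summable_monom_series:
  assumes "compact_space K" "g \<in> CK K" "range x \<subseteq> topspace K" "p \<in> hilbert_cube"
  shows "summable (\<lambda>n. (1/2) ^ n * monom_at n p * g (x n))"
proof -
  obtain B where "\<And>x. x \<in> topspace K \<Longrightarrow> \<bar>g x\<bar> \<le> B" using CK_bounded assms by blast
  then have "norm ((1/2) ^ n * monom_at n p * g (x n)) \<le> (1/2) ^ n * B" for n
    using assms(3,4) by (intro monom_series_term_bound) auto
  then show ?thesis by (intro summable_comparison_test'[OF summable_geometric_half_mult]) 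
qed

lemma monom_series_in_CK_dual:
  assumes K: "compact_space K" and x: "range x \<subseteq> topspace K" and p: "p \<in> hilbert_cube"
  shows "monom_series x p \<in> CK_dual K"
  unfolding CK_dual_def
proof (intro CollectI conjI ballI allI)
  note sm = summable_monom_series[OF K _ x p]
  have xn: "x n \<in> topspace K" for n using x by auto
  show "monom_series x p (\<lambda>y\<in>topspace K. f y + g y) = monom_series x p f + monom_series x p g"
    if "f \<in> CK K" "g \<in> CK K" for f g
    unfolding monom_series_def suminf_add[OF sm[OF that(1)] sm[OF that(2)]]
    using xn by (simp add: algebra_simps)
  show "monom_series x p (\<lambda>y\<in>topspace K. c * f y) = c * monom_series x p f" if "f \<in> CK K" for f c
    unfolding monom_series_def suminf_mult[OF sm[OF that], symmetric]
    using xn by (simp add: algebra_simps)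
  have "Lipschitz_continuous_map (CK_metric K) euclidean_metric (monom_series x p)"
    unfolding Lipschitz_continuous_map_def
  \<comment> \<open>The Lipschitz constant 2 is the sum of the weights \<open>(1/2) ^ n\<close>,
    since monomials are at most 1 on the cube.\<close>
  proof (intro conjI exI[of _ 2] ballI)
    fix f g assume "f \<in> mspace (CK_metric K)" "g \<in> mspace (CK_metric K)"
    then have fg: "f \<in> CK K" "g \<in> CK K" by (auto simp: CK_def)
    let ?d = "mdist (CK_metric K) f g"
    have d: "\<bar>f (x n) - g (x n)\<bar> \<le> ?d" for n
      using mdist_cfunspace_imp_mdist_le[of f K euclidean_metric g ?d "x n"] fg xn
      by (simp add: CK_def CK_metric_def dist_real_def)
    have "norm (\<Sum>n. (1/2) ^ n * monom_at n p * (f (x n) - g (x n))) \<le> (\<Sum>n. (1/2) ^ n * ?d)"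
      by (rule norm_suminf_le[OF monom_series_term_bound[OF p d] summable_geometric_half_mult])
    also have "\<dots> = 2 * ?d"
      by (subst suminf_mult2[symmetric]) (auto simp: suminf_geometric summable_geometric)
    also have "(\<Sum>n. (1/2) ^ n * monom_at n p * (f (x n) - g (x n))) = monom_series x p f - monom_series x p g"
      unfolding monom_series_def suminf_diff[OF sm[OF fg(1)] sm[OF fg(2)]]
      by (simp add: algebra_simps)
    finally show "mdist euclidean_metric (monom_series x p f) (monom_series x p g) \<le> 2 * ?d"
      by (simp add: dist_real_def)
  qed auto
  then show "continuous_map (mtopology_of (CK_metric K)) euclideanreal (monom_series x p)"
    using Lipschitz_continuous_imp_continuous_map by fastforce
qed

lemma continuous_on_monom_series:
  assumes K: "compact_space K" and x: "range x \<subseteq> topspace K" and g: "g \<in> CK K"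
  shows "continuous_on hilbert_cube (\<lambda>p. monom_series x p g)"
proof -
  obtain B where B: "\<And>x. x \<in> topspace K \<Longrightarrow> \<bar>g x\<bar> \<le> B" using CK_bounded K g by blast
  have "uniform_limit hilbert_cube (\<lambda>n p. \<Sum>i<n. (1/2) ^ i * monom_at i p * g (x i))
      (\<lambda>p. \<Sum>i. (1/2) ^ i * monom_at i p * g (x i)) sequentially"
    by (rule Weierstrass_m_test[OF monom_series_term_bound summable_geometric_half_mult[of B]])
      (use B x in auto)
  then have "continuous_on hilbert_cube (\<lambda>p. \<Sum>i. (1/2) ^ i * monom_at i p * g (x i))"
    by (rule uniform_limit_theorem[rotated])
      (auto intro!: always_eventually continuous_on_sum continuous_on_mult continuous_on_monom_at)
  then show ?thesis by (simp add: monom_series_def)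
qed

text \<open>Compactness gives an accumulation point \<open>z\<close>. Points at strictly decreasing
  distances from \<open>z\<close> are told apart by tent functions of the distance to
  \<open>z\<close>.\<close>

lemma infinite_compact_metrizable_isolated_sequence:
  assumes M: "compact_space M" "metrizable_space M" "infinite (topspace M)"
  shows "\<exists>(x :: nat \<Rightarrow> 'm) (\<phi> :: nat \<Rightarrow> 'm \<Rightarrow> real). range x \<subseteq> topspace M \<and>
    (\<forall>n. continuous_map M euclideanreal (\<phi> n)) \<and> (\<forall>n j. \<phi> n (x j) = (if j = n then 1 else 0))"
proof -
  obtain X d where Xd: "Metric_space X d" "M = Metric_space.mtopology X d"
    using M(2) unfolding metrizable_space_def by blast
  interpret Metric_space X d by fact
  have M': "M = mtopology" by fact
  have "X \<inter> mtopology derived_set_of X \<noteq> {}"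
    using compactin_imp_Bolzano_Weierstrass[of mtopology X X] M(1,3)
    by (simp add: M' compact_space_def)
  then obtain z where z: "z \<in> X" "\<And>r. r > 0 \<Longrightarrow> \<exists>y\<in>X. y \<noteq> z \<and> y \<in> mball z r"
    unfolding metric_derived_set_of by blast
  define u where "u = d z"
  have u: "continuous_map M euclideanreal u"
    using continuous_on_mdist[of z "metric (X, d)"] z(1)
    by (simp add: u_def M' mtopology_of_def)
  have small: "\<exists>y. (y \<in> X \<and> 0 < u y) \<and> u y < e" if "e > 0" for e
    using z(2)[OF that] z(1) by (auto simp: u_def)
  obtain x where x: "\<And>n. x n \<in> X \<and> 0 < u (x n)" "\<And>n. u (x (Suc n)) < u (x n)"
  proof -
    have "\<exists>f. \<forall>n. (f n \<in> X \<and> 0 < u (f n)) \<and> u (f (Suc n)) < u (f n)"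
    proof (rule dependent_nat_choice)
      show "\<exists>y. y \<in> X \<and> 0 < u y" using small[of 1] by auto
      show "\<exists>y'. (y' \<in> X \<and> 0 < u y') \<and> u y' < u y" if "y \<in> X \<and> 0 < u y" for y and n :: nat
        using small that by blast
    qed
    then show ?thesis using that by blast
  qed
  define t where "t n = u (x n)" for n
  have tdec: "t j < t i" if "i < j" for i j
    using that x(2) unfolding t_def by (rule lift_Suc_mono_less[of "\<lambda>n. - u (x n)" i j, simplified, rotated])
  \<comment> \<open>The half-width of the tent is the gap from \<open>t n\<close> to its nearest
    neighbour among the distances; for \<open>n = 0\<close> there is no predecessor, and 1 stands in
    for that gap.\<close>
  define \<delta> where "\<delta> n = min (t n - t (Suc n)) (if n = 0 then 1 else t (n - 1) - t n)" for n
  have \<delta>pos: "\<delta> n > 0" for n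
    using tdec[of n "Suc n"] tdec[of "n - 1" n] by (auto simp: \<delta>_def)
  have far: "\<delta> n \<le> \<bar>t j - t n\<bar>" if "j \<noteq> n" for j n
  proof (cases "j < n")
    case True
    then have "t (n - 1) \<le> t j" using tdec[of j "n - 1"] by (cases "j = n - 1") (auto intro: less_imp_le)
    then show ?thesis using True by (auto simp: \<delta>_def)
  next
    case False
    then have "t j \<le> t (Suc n)" using that tdec[of "Suc n" j] by (cases "j = Suc n") (auto intro: less_imp_le)
    then show ?thesis by (auto simp: \<delta>_def)
  qed
  define \<phi> where "\<phi> n y = max 0 (1 - \<bar>u y - t n\<bar> * inverse (\<delta> n))" for n y
  have "continuous_map M euclideanreal (\<phi> n)" for n
    unfolding \<phi>_def
    by (intro continuous_map_real_max continuous_map_diff continuous_map_real_mult continuous_map_real_abs u)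
      auto
  moreover have "\<phi> n (x j) = (if j = n then 1 else 0)" for n j
  proof (cases "j = n")
    case False
    have "1 \<le> \<bar>t j - t n\<bar> * inverse (\<delta> n)"
      using far[OF False] \<delta>pos[of n] by (simp add: field_simps)
    then show ?thesis using False by (simp add: \<phi>_def flip: t_def)
  qed (simp add: \<phi>_def t_def)
  moreover have "range x \<subseteq> topspace M" using x(1) by (auto simp: M')
  ultimately show ?thesis by blast
qed

text \<open>Every polynomial in the coordinates arises as
  \<open>\<lambda>p. monom_series x p g\<close> for some \<open>g\<close>: monomials come from the
  functions \<open>\<phi> n\<close>, the rest from linearity. The polynomial used has one linear
  factor for each \<open>p\<close> in \<open>S\<close>, in a coordinate where \<open>p\<close> and
  \<open>q\<close> differ, and is then normalised at \<open>q\<close>.\<close>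

lemma monom_series_interpolation:
  assumes M: "compact_space M" and x: "range x \<subseteq> topspace M"
    and \<phi>: "\<And>n. continuous_map M euclideanreal (\<phi> n)"
      "\<And>n j. \<phi> n (x j) = (if j = n then 1 else 0)"
    and S: "finite S" "q \<notin> S" "insert q S \<subseteq> hilbert_cube"
  shows "\<exists>g\<in>CK M. monom_series x q g = 1 \<and> (\<forall>p\<in>S. monom_series x p g = 0)"
proof -
  define R where "R b \<longleftrightarrow> (\<exists>g\<in>CK M. \<forall>p\<in>hilbert_cube. monom_series x p g = b p)" for b
  have xn: "x n \<in> topspace M" for n using x by blast
  have R_monom: "R (\<lambda>p. prod_list (map p l))" for l
  proof -
    \<comment> \<open>The number \<open>n\<close> codes the list \<open>l\<close> of coordinate
      indices, and the factor \<open>2 ^ n\<close> below cancels the weight of the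
      \<open>n\<close>-th term.\<close>
    define n where "n = to_nat l"
    let ?g = "\<lambda>y\<in>topspace M. 2 ^ n * \<phi> n y"
    have "?g \<in> CK M"
      using M by (auto simp: CK_compact intro!: continuous_map_eq[where f = "\<lambda>y. 2 ^ n * \<phi> n y"]
          continuous_map_real_mult_left \<phi>(1))
    moreover have "monom_series x p ?g = prod_list (map p l)" for p
    proof -
      have "(\<Sum>k. (1/2) ^ k * monom_at k p * ?g (x k)) = (\<Sum>k\<in>{n}. (1/2) ^ k * monom_at k p * ?g (x k))"
        by (rule suminf_finite) (use xn \<phi>(2) in auto)
      then show ?thesis
        using xn \<phi>(2) by (simp add: monom_series_def monom_at_def n_def power_one_over)
    qed
    ultimately show ?thesis unfolding R_def by blast
  qed
  have R_comb: "R (\<lambda>p. b p + c * b' p)" if Rb: "R b" "R b'" for b b' c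
  proof -
    obtain g g' where g: "g \<in> CK M" "g' \<in> CK M"
      "\<forall>p\<in>hilbert_cube. monom_series x p g = b p" "\<forall>p\<in>hilbert_cube. monom_series x p g' = b' p"
      using Rb unfolding R_def by blast
    have "monom_series x p (\<lambda>y\<in>topspace M. g y + c * g' y) = b p + c * b' p" if "p \<in> hilbert_cube" for p
      using CK_dual_add_scale[OF M monom_series_in_CK_dual[OF M x that] g(1,2)] g(3,4) that by simp
    then show ?thesis
      unfolding R_def using CK_add_scale[OF M g(1,2)] by blast
  qed
  \<comment> \<open>Linear factors are multiplied out one by one. The leading monomial must stay
    arbitrary, since the summand \<open>p i\<close> of a factor is absorbed into it.\<close>
  have R_prod: "R (\<lambda>p. prod_list (map p l) * (\<Prod>(i, c)\<leftarrow>s. p i - c))" for l and s :: "(nat \<times> real) list"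
  proof (induction s arbitrary: l)
    case Nil
    then show ?case using R_monom by simp
  next
    case (Cons ic s)
    obtain i c where ic: "ic = (i, c)" by (cases ic)
    have "(\<lambda>p. prod_list (map p (i # l)) * (\<Prod>(i, c)\<leftarrow>s. p i - c) + - c * (prod_list (map p l) * (\<Prod>(i, c)\<leftarrow>s. p i - c)))
      = (\<lambda>p. prod_list (map p l) * (\<Prod>(i, c)\<leftarrow>ic # s. p i - c))"
      by (auto simp: ic algebra_simps)
    with R_comb[OF Cons.IH[of "i # l"] Cons.IH[of l], of "- c"] show ?case by simp
  qed
  have "\<forall>p\<in>S. \<exists>i. p i \<noteq> q i" using S(2) by (metis ext)
  from bchoice[OF this] obtain k where k: "\<And>p. p \<in> S \<Longrightarrow> p (k p) \<noteq> q (k p)" by blast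
  obtain ps where ps: "set ps = S" using finite_list[OF S(1)] by blast
  define s where "s = map (\<lambda>p. (k p, p (k p))) ps"
  define b where "b p = (\<Prod>(i, c)\<leftarrow>s. p i - c)" for p :: "nat \<Rightarrow> real"
  have b0: "b p = 0" if "p \<in> S" for p
    using that ps by (auto simp: b_def s_def prod_list_zero_iff comp_def)
  have bq: "b q \<noteq> 0"
    using k ps by (fastforce simp: b_def s_def prod_list_zero_iff comp_def)
  have "R b" using R_prod[of "[]" s] by (simp add: b_def[abs_def])
  then obtain g where g: "g \<in> CK M" "\<And>p. p \<in> hilbert_cube \<Longrightarrow> monom_series x p g = b p"
    unfolding R_def by blast
  have val: "monom_series x p (\<lambda>y\<in>topspace M. inverse (b q) * g y) = inverse (b q) * b p"
    if "p \<in> hilbert_cube" for p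
    using CK_dual_scale[OF monom_series_in_CK_dual[OF M x that] g(1)] g(2)[OF that] by simp
  show ?thesis
  proof (intro bexI[OF _ CK_scale[OF M g(1), of "inverse (b q)"]] conjI ballI)
    show "monom_series x q (\<lambda>y\<in>topspace M. inverse (b q) * g y) = 1"
      using val[of q] S(3) bq by simp
    show "monom_series x p (\<lambda>y\<in>topspace M. inverse (b q) * g y) = 0" if "p \<in> S" for p
      using val[of p] S(3) b0[OF that] that by auto
  qed
qed

text \<open>The last clause says that few functionals vanish on the common kernel of
  \<open>J\<close>, the form in which controlling sets use independence. If
  \<open>card J + 1\<close> of them did, take functions biorthogonal to them. A nontrivial
  combination of these is killed by \<open>J\<close>, hence by the chosen functionals, whose values
  on it are its coefficients.\<close>

lemma independent_hilbert_cube_of_functionals: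
  assumes M: "compact_space M" "metrizable_space M" "infinite (topspace M)"
  shows "\<exists>\<mu> :: (nat \<Rightarrow> real) \<Rightarrow> ('m \<Rightarrow> real) \<Rightarrow> real.
    (\<forall>p\<in>hilbert_cube. \<mu> p \<in> CK_dual M) \<and>
    (\<forall>g\<in>CK M. continuous_on hilbert_cube (\<lambda>p. \<mu> p g)) \<and>
    (\<forall>J. finite J \<and> J \<subseteq> CK_dual M \<longrightarrow>
       finite {p \<in> hilbert_cube. \<forall>g\<in>CK M. (\<forall>\<nu>\<in>J. \<nu> g = 0) \<longrightarrow> \<mu> p g = 0})"
proof -
  obtain x :: "nat \<Rightarrow> 'm" and \<phi> where x: "range x \<subseteq> topspace M" and \<phi>: "\<And>n. continuous_map M euclideanreal (\<phi> n)"
    "\<And>n j. \<phi> n (x j) = (if j = n then 1 else (0::real))"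
    using infinite_compact_metrizable_isolated_sequence[OF M] by auto
  have fin: "finite {p \<in> hilbert_cube. \<forall>g\<in>CK M. (\<forall>\<nu>\<in>J. \<nu> g = 0) \<longrightarrow> monom_series x p g = 0}" (is "finite ?B")
    if J: "finite J" "J \<subseteq> CK_dual M" for J
  proof (rule ccontr)
    assume "infinite ?B"
    then obtain P where P: "finite P" "card P = Suc (card J)" "P \<subseteq> ?B"
      using infinite_arbitrarily_large by blast
    have "\<forall>q\<in>P. \<exists>g. g \<in> CK M \<and> (\<forall>p\<in>P. monom_series x p g = (if p = q then 1 else 0))"
    proof
      fix q assume q: "q \<in> P"
      have 1: "finite (P - {q})" "q \<notin> P - {q}" "insert q (P - {q}) \<subseteq> hilbert_cube"
        using P q by auto
      obtain g where "g \<in> CK M" "monom_series x q g = 1" "\<And>p. p \<in> P - {q} \<Longrightarrow> monom_series x p g = 0"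
        using monom_series_interpolation[where \<phi> = \<phi>, OF M(1) x \<phi> 1] by auto
      then show "\<exists>g. g \<in> CK M \<and> (\<forall>p\<in>P. monom_series x p g = (if p = q then 1 else 0))"
        by (intro exI[of _ g]) auto
    qed
    from bchoice[OF this] obtain g where g: "\<And>q. q \<in> P \<Longrightarrow> g q \<in> CK M"
      "\<And>q p. q \<in> P \<Longrightarrow> p \<in> P \<Longrightarrow> monom_series x p (g q) = (if p = q then 1 else 0)" by blast
    obtain c where c: "\<exists>q\<in>P. c q \<noteq> 0" "\<forall>\<nu>\<in>J. (\<Sum>q\<in>P. c q * \<nu> (g q)) = 0"
      using homogeneous_system_nontrivial_solution[of J P "\<lambda>\<nu> q. \<nu> (g q)"] J(1) P(1,2) by auto
    define h where "h = (\<lambda>y\<in>topspace M. \<Sum>q\<in>P. c q * g q y)"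
    have h: "h \<in> CK M" "\<And>\<nu>. \<nu> \<in> CK_dual M \<Longrightarrow> \<nu> h = (\<Sum>q\<in>P. c q * \<nu> (g q))"
      using CK_dual_sum[OF M(1) P(1) g(1), of "\<lambda>q. q" c] unfolding h_def by blast+
    have "\<nu> h = 0" if "\<nu> \<in> J" for \<nu>
      using h(2)[of \<nu>] c(2) J(2) that by auto
    then have z: "monom_series x p h = 0" if "p \<in> P" for p
      using that P(3) h(1) by blast
    have "c p = 0" if p: "p \<in> P" for p
    proof -
      have "p \<in> hilbert_cube" using p P(3) by blast
      then have "monom_series x p h = (\<Sum>q\<in>P. c q * monom_series x p (g q))"
        by (intro h(2) monom_series_in_CK_dual[OF M(1) x])
      also have "\<dots> = (\<Sum>q\<in>P. if q = p then c q else 0)"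
        using g(2) p by (intro sum.cong) auto
      also have "\<dots> = c p" using p P(1) by simp
      finally show ?thesis using z[OF p] by simp
    qed
    then show False using c(1) by blast
  qed
  show ?thesis
    by (intro exI[of _ "monom_series x"] conjI ballI allI impI monom_series_in_CK_dual[OF M(1) x]
      continuous_on_monom_series[OF M(1) x] fin) auto
qed

subsection \<open>Controlling sets\<close>

text \<open>A subbasic neighbourhood of 0 contains the kernel of its functional; intersections
  collect the functionals, and a union needs only the member containing 0.\<close>

lemma C_w_open_contains_kernel:
  assumes M: "compact_space M" and "openin (C_w M) W" "(\<lambda>x\<in>topspace M. 0) \<in> W"
  shows "\<exists>J. finite J \<and> J \<subseteq> CK_dual M \<and> (\<forall>g\<in>CK M. (\<forall>\<nu>\<in>J. \<nu> g = 0) \<longrightarrow> g \<in> W)"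
proof -
  have "generate_topology_on {{f \<in> CK M. \<phi> f \<in> U} |\<phi> U. \<phi> \<in> CK_dual M \<and> open U} W"
    using assms(2) unfolding C_w_def by (rule openin_topology_generated_by)
  then show ?thesis using assms(3)
  proof (induction W rule: generate_topology_on.induct)
    case Empty
    then show ?case by blast
  next
    case (Int a b)
    then obtain J J' where "finite J \<and> J \<subseteq> CK_dual M \<and> (\<forall>g\<in>CK M. (\<forall>\<nu>\<in>J. \<nu> g = 0) \<longrightarrow> g \<in> a)"
      "finite J' \<and> J' \<subseteq> CK_dual M \<and> (\<forall>g\<in>CK M. (\<forall>\<nu>\<in>J'. \<nu> g = 0) \<longrightarrow> g \<in> b)" by blast
    then show ?case by (intro exI[of _ "J \<union> J'"]) auto
  next
    case (UN K)
    then obtain k where k: "k \<in> K" "(\<lambda>x\<in>topspace M. 0) \<in> k" by blast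
    from UN.IH[OF k] k(1) show ?case by blast
  next
    case (Basis s)
    then obtain \<phi> U where s: "s = {f \<in> CK M. \<phi> f \<in> U}" "\<phi> \<in> CK_dual M" by blast
    then have "\<phi> (\<lambda>x\<in>topspace M. 0) \<in> U" using Basis.prems by blast
    then have "0 \<in> U" using CK_dual_zero[OF M s(2)] by simp
    then show ?case using s by (intro exI[of _ "{\<phi>}"]) auto
  qed
qed

lemma continuous_map_CK_dual:
  assumes "\<nu> \<in> CK_dual M"
  shows "continuous_map (C_w M) euclideanreal \<nu>"
  unfolding continuous_map_def
proof (intro conjI allI impI)
  fix U :: "real set" assume "openin euclidean U"
  then have "{f \<in> CK M. \<nu> f \<in> U} \<in> {{f \<in> CK M. \<phi> f \<in> U} |\<phi> U. \<phi> \<in> CK_dual M \<and> open U}"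
    using assms by auto
  then show "openin (C_w M) {f \<in> topspace (C_w M). \<nu> f \<in> U}"
    unfolding topspace_C_w unfolding C_w_def by (rule topology_generated_by_Basis)
qed auto

lemma continuous_map_C_p_eval:
  assumes "a \<in> topspace K"
  shows "continuous_map (C_p K) euclideanreal (\<lambda>f. f a)"
  unfolding C_p_def
  by (intro continuous_map_from_subtopology continuous_map_product_projection assms)

lemma C_p_open_basic:
  assumes "openin (C_p K) W" "f \<in> W"
  shows "\<exists>F e. finite F \<and> F \<subseteq> topspace K \<and> e > 0 \<and> (\<forall>h\<in>CK K. (\<forall>x\<in>F. \<bar>h x - f x\<bar> < e) \<longrightarrow> h \<in> W)"
proof -
  obtain S where S: "openin (powertop_real (topspace K)) S" "W = S \<inter> CK K"
    using assms(1) unfolding C_p_def openin_subtopology by blast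
  have fS: "f \<in> S" using S(2) assms(2) by blast
  obtain U where U: "finite {i \<in> topspace K. U i \<noteq> UNIV}" "\<And>i. i \<in> topspace K \<Longrightarrow> open (U i)"
    "f \<in> Pi\<^sub>E (topspace K) U" "Pi\<^sub>E (topspace K) U \<subseteq> S"
    using S(1) fS unfolding openin_product_topology_alt by auto
  define F where "F = {i \<in> topspace K. U i \<noteq> UNIV}"
  have "\<forall>x\<in>F. \<exists>e>0. \<forall>y. \<bar>y - f x\<bar> < e \<longrightarrow> y \<in> U x"
  proof
    fix x assume "x \<in> F"
    then have "open (U x)" "f x \<in> U x" using U(2,3) by (auto simp: F_def)
    then show "\<exists>e>0. \<forall>y. \<bar>y - f x\<bar> < e \<longrightarrow> y \<in> U x"
      unfolding open_dist by (auto simp: dist_real_def)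
  qed
  from bchoice[OF this] obtain e where e: "\<And>x. x \<in> F \<Longrightarrow> e x > 0"
    "\<And>x y. x \<in> F \<Longrightarrow> \<bar>y - f x\<bar> < e x \<Longrightarrow> y \<in> U x" by blast
  define e0 where "e0 = Min (insert 1 (e ` F))"
  have finF: "finite F" using U(1) by (simp add: F_def)
  have e0: "e0 > 0" "\<And>x. x \<in> F \<Longrightarrow> e0 \<le> e x"
    using finF e(1) by (auto simp: e0_def)
  have "h \<in> W" if h: "h \<in> CK K" "\<forall>x\<in>F. \<bar>h x - f x\<bar> < e0" for h
  proof -
    have "h x \<in> U x" if x: "x \<in> topspace K" for x
    proof (cases "x \<in> F")
      case True
      then have "\<bar>h x - f x\<bar> < e x" using h(2) e0(2) by fastforce
      then show ?thesis by (rule e(2)[OF True])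
    qed (use x in \<open>auto simp: F_def\<close>)
    moreover have "h \<in> extensional (topspace K)"
      using h(1) by (simp add: CK_def CK_metric_def)
    ultimately have "h \<in> Pi\<^sub>E (topspace K) U" by (auto simp: PiE_iff)
    then show ?thesis using U(4) S(2) h(1) by blast
  qed
  then show ?thesis using finF e0(1) by (intro exI[of _ F] exI[of _ e0]) (auto simp: F_def)
qed

text \<open>A Urysohn function that is 1 on \<open>A\<close> and 0 on \<open>B\<close> blends
  \<open>f\<close> and \<open>g\<close>.\<close>

lemma CK_patch:
  assumes K: "compact_space K" "Hausdorff_space K" and f: "f \<in> CK K" "g \<in> CK K"
    and AB: "finite A" "finite B" "A \<subseteq> topspace K" "B \<subseteq> topspace K" "A \<inter> B = {}"
  shows "\<exists>h\<in>CK K. (\<forall>x\<in>A. h x = f x) \<and> (\<forall>x\<in>B. h x = g x)"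
proof -
  have cl: "closedin K B" "closedin K A" "disjnt B A"
    using AB Hausdorff_imp_t1_space[OF K(2)] unfolding t1_space_closedin_finite disjnt_def by blast+
  have "normal_space K"
    using K compact_Hausdorff_or_regular_imp_normal_space by blast
  from Urysohn_lemma_alt[OF this cl, of 0 1] obtain u
    where uc: "continuous_map K euclideanreal u" and u: "u ` B \<subseteq> {0}" "u ` A \<subseteq> {1}"
    by blast
  let ?h = "\<lambda>x\<in>topspace K. g x + u x * (f x - g x)"
  have "?h \<in> CK K"
    using f uc unfolding CK_compact[OF K(1)]
    by (auto intro!: continuous_map_eq[where f = "\<lambda>x. g x + u x * (f x - g x)"]
      continuous_map_add continuous_map_real_mult continuous_map_diff)
  moreover have "?h x = f x" if "x \<in> A" for x using that u(2) AB(3) by (auto simp: subset_iff)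
  moreover have "?h x = g x" if "x \<in> B" for x using that u(1) AB(4) by (auto simp: subset_iff)
  ultimately show ?thesis by (intro bexI[of _ ?h]) auto
qed

text \<open>The strict bound in the premise and the weak bound in the conclusion make this a closed
  condition when \<open>\<psi>\<close> and an enumeration of \<open>A\<close> vary continuously. The
  radii \<open>1 / Suc k\<close> keep the number of cases countable.\<close>

definition controls :: "'t topology \<Rightarrow> ('t \<Rightarrow> 'k \<Rightarrow> real) \<Rightarrow> 't \<Rightarrow> ('t \<Rightarrow> real) \<Rightarrow> nat \<Rightarrow> 'k set \<Rightarrow> bool" where
  "controls T \<Phi> w0 \<psi> k A \<longleftrightarrow>
     (\<forall>w\<in>topspace T. (\<forall>a\<in>A. \<bar>\<Phi> w a - \<Phi> w0 a\<bar> < 1 / Suc k) \<longrightarrow> \<bar>\<psi> w\<bar> \<le> 1)"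

text \<open>The map \<open>\<Phi>\<close> is open, so the image of the set where
  \<open>\<bar>\<psi>\<bar> < 1\<close> contains a basic pointwise neighbourhood of
  \<open>\<Phi> w0\<close>, which supplies \<open>A\<close> and \<open>k\<close>.\<close>

lemma controls_exists:
  assumes \<Phi>: "homeomorphic_map T (C_p K) \<Phi>" and w0: "w0 \<in> topspace T"
    and \<psi>: "continuous_map T euclideanreal \<psi>" "\<psi> w0 = 0"
  shows "\<exists>k A. finite A \<and> A \<subseteq> topspace K \<and> controls T \<Phi> w0 \<psi> k A"
proof -
  let ?W = "{w \<in> topspace T. \<psi> w \<in> {-1<..<1}}"
  have "openin T ?W" using \<psi>(1) by (rule openin_continuous_map_preimage) simp
  then have "openin (C_p K) (\<Phi> ` ?W)"
    using \<Phi> homeomorphic_imp_open_map unfolding open_map_def by blast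
  moreover have "\<Phi> w0 \<in> \<Phi> ` ?W" using w0 \<psi>(2) by auto
  ultimately obtain F e where F: "finite F" "F \<subseteq> topspace K" "e > 0"
    "\<And>h. h \<in> CK K \<Longrightarrow> (\<forall>x\<in>F. \<bar>h x - \<Phi> w0 x\<bar> < e) \<Longrightarrow> h \<in> \<Phi> ` ?W"
    using C_p_open_basic[of K "\<Phi> ` ?W" "\<Phi> w0"] by auto
  obtain k where k: "1 / Suc k < e" using nat_approx_posE[OF F(3)] by blast
  have "controls T \<Phi> w0 \<psi> k F"
    unfolding controls_def
  proof (intro ballI impI)
    fix w assume w: "w \<in> topspace T" "\<forall>a\<in>F. \<bar>\<Phi> w a - \<Phi> w0 a\<bar> < 1 / Suc k"
    have "\<Phi> w \<in> CK K"
      using \<Phi> w(1) homeomorphic_imp_surjective_map topspace_C_p by blast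
    then have "\<Phi> w \<in> \<Phi> ` ?W" using F(4) w(2) k less_trans by blast
    moreover have "inj_on \<Phi> (topspace T)" using \<Phi> homeomorphic_imp_injective_map by blast
    ultimately have "w \<in> ?W" using w(1) by (auto dest: inj_onD)
    then show "\<bar>\<psi> w\<bar> \<le> 1" by auto
  qed
  with F(1,2) show ?thesis by blast
qed

text \<open>If infinitely many controlling sets had the least possible size, a largest set \<open>R\<close>
  contained in infinitely many of them would not be controlling. A function witnessing this
  can be altered off \<open>R\<close> and off any given finite set, hence on \<open>A - R\<close> for a suitable
  controlling \<open>A \<supseteq> R\<close>, without leaving a given neighbourhood.\<close>

lemma finite_minimal_controls:
  assumes K: "compact_space K" "Hausdorff_space K"
    and \<Phi>: "homeomorphic_map T (C_p K) \<Phi>" and w0: "w0 \<in> topspace T"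
    and \<psi>: "continuous_map T euclideanreal \<psi>"
    and min: "\<And>A. finite A \<Longrightarrow> A \<subseteq> topspace K \<Longrightarrow> controls T \<Phi> w0 \<psi> k A \<Longrightarrow> m \<le> card A"
  shows "finite {A. finite A \<and> A \<subseteq> topspace K \<and> card A = m \<and> controls T \<Phi> w0 \<psi> k A}" (is "finite ?\<A>")
proof (rule ccontr)
  assume inf: "infinite ?\<A>"
  define P where "P R \<longleftrightarrow> finite R \<and> infinite {A \<in> ?\<A>. R \<subseteq> A}" for R
  have PR: "card R < m \<and> R \<subseteq> topspace K" if "P R" for R
  proof -
    have fin: "finite R" and inf: "infinite {A \<in> ?\<A>. R \<subseteq> A}" using that by (auto simp: P_def)
    from inf have "\<not> {A \<in> ?\<A>. R \<subseteq> A} \<subseteq> {R}" using finite_subset by blast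
    then obtain A where A: "A \<in> ?\<A>" "R \<subseteq> A" "A \<noteq> R" by blast
    then have "card R < card A" by (intro psubset_card_mono) auto
    then show ?thesis using A by auto
  qed
  have "P {}" using inf by (simp add: P_def)
  then obtain R where R: "P R" "\<And>R'. P R' \<Longrightarrow> card R' \<le> card R"
    using ex_has_greatest_nat[of P "{}" card m] PR less_imp_le by blast
  have finR: "finite R" using R(1) by (simp add: P_def)
  have RK: "R \<subseteq> topspace K" "card R < m" using PR[OF R(1)] by auto
  \<comment> \<open>Otherwise each of the infinitely many sets above \<open>R\<close> would meet the
    finite set \<open>F - R\<close>, so one point of it could be added to \<open>R\<close>, against
    maximality.\<close>
  have avoid: "\<exists>A\<in>?\<A>. R \<subseteq> A \<and> (A - R) \<inter> F = {}" if F: "finite F" for F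
  proof (rule ccontr)
    assume none: "\<not> (\<exists>A\<in>?\<A>. R \<subseteq> A \<and> (A - R) \<inter> F = {})"
    have "{A \<in> ?\<A>. R \<subseteq> A} \<subseteq> (\<Union>a\<in>F - R. {A \<in> ?\<A>. insert a R \<subseteq> A})"
    proof
      fix A assume A: "A \<in> {A \<in> ?\<A>. R \<subseteq> A}"
      then obtain a where "a \<in> A - R" "a \<in> F" using none by blast
      with A show "A \<in> (\<Union>a\<in>F - R. {A \<in> ?\<A>. insert a R \<subseteq> A})" by auto
    qed
    moreover have "finite {A \<in> ?\<A>. insert a R \<subseteq> A}" if a: "a \<in> F - R" for a
    proof (rule ccontr)
      assume "infinite {A \<in> ?\<A>. insert a R \<subseteq> A}"
      then have "P (insert a R)" using finR by (simp add: P_def)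
      from R(2)[OF this] show False using a finR by simp
    qed
    ultimately have "finite {A \<in> ?\<A>. R \<subseteq> A}"
      using F by (meson finite_Diff finite_UN_I finite_subset)
    then show False using R(1) by (simp add: P_def)
  qed
  have "\<not> controls T \<Phi> w0 \<psi> k R" using min[OF finR RK(1)] RK(2) by auto
  then obtain w where w: "w \<in> topspace T" "\<And>a. a \<in> R \<Longrightarrow> \<bar>\<Phi> w a - \<Phi> w0 a\<bar> < 1 / Suc k" "\<bar>\<psi> w\<bar> > 1"
    unfolding controls_def by auto
  let ?W = "{w \<in> topspace T. \<psi> w \<in> - {-1..1}}"
  have surj: "\<Phi> ` topspace T = CK K"
    using \<Phi> homeomorphic_imp_surjective_map topspace_C_p by blast
  have "openin T ?W" using \<psi> by (rule openin_continuous_map_preimage) auto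
  then have "openin (C_p K) (\<Phi> ` ?W)"
    using \<Phi> homeomorphic_imp_open_map unfolding open_map_def by blast
  moreover have "\<Phi> w \<in> \<Phi> ` ?W" using w by auto
  ultimately obtain F e where F: "finite F" "F \<subseteq> topspace K" "e > 0"
    "\<And>h. h \<in> CK K \<Longrightarrow> (\<forall>x\<in>F. \<bar>h x - \<Phi> w x\<bar> < e) \<Longrightarrow> h \<in> \<Phi> ` ?W"
    using C_p_open_basic[of K "\<Phi> ` ?W" "\<Phi> w"] by auto
  obtain A where A: "A \<in> ?\<A>" "R \<subseteq> A" "(A - R) \<inter> F = {}" using avoid[OF F(1)] by blast
  \<comment> \<open>Agreement with \<open>\<Phi> w\<close> on \<open>F\<close> keeps
    \<open>h\<close> in the image of the set where \<open>\<bar>\<psi>\<bar> > 1\<close>, while on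
    \<open>A\<close> the function is close to \<open>\<Phi> w0\<close>: on \<open>R\<close> by the
    choice of \<open>w\<close>, on \<open>A - R\<close> by equality.\<close>
  have "\<exists>h\<in>CK K. (\<forall>x\<in>F \<union> R. h x = \<Phi> w x) \<and> (\<forall>x\<in>A - R. h x = \<Phi> w0 x)"
    by (rule CK_patch[OF K]) (use w(1) w0 surj F finR RK A in auto)
  then obtain h where h: "h \<in> CK K" "\<forall>x\<in>F \<union> R. h x = \<Phi> w x" "\<forall>x\<in>A - R. h x = \<Phi> w0 x" by blast
  have "h \<in> \<Phi> ` ?W" by (rule F(4)[OF h(1)]) (use h(2) F(3) in auto)
  then obtain v where v: "v \<in> topspace T" "\<psi> v \<notin> {-1..1}" "h = \<Phi> v" by blast
  have "\<bar>\<Phi> v a - \<Phi> w0 a\<bar> < 1 / Suc k" if "a \<in> A" for a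
    using that w(2) h(2,3) v(3) by (cases "a \<in> R") auto
  then have "\<bar>\<psi> v\<bar> \<le> 1" using A(1) v(1) unfolding controls_def by blast
  then show False using v(2) by auto
qed

text \<open>The set \<open>J\<close> is read off from a neighbourhood determined by \<open>A\<close>
  and \<open>k\<close>, before \<open>\<mu>\<close> is chosen, so one \<open>J\<close> serves all
  functionals that \<open>A\<close> controls. Each of them is bounded on the linear subspace where
  \<open>J\<close> vanishes, hence zero there.\<close>

lemma controls_kernel:
  assumes M: "compact_space M" and A: "finite A" "A \<subseteq> topspace K"
    and \<Phi>: "continuous_map (prod_topology (C_w M) E) (C_p K) \<Phi>" and e0: "e0 \<in> topspace E"
  defines "w0 \<equiv> ((\<lambda>x\<in>topspace M. 0), e0)"
  shows "\<exists>J. finite J \<and> J \<subseteq> CK_dual M \<and> (\<forall>\<mu>\<in>CK_dual M.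
    controls (prod_topology (C_w M) E) \<Phi> w0 (\<lambda>w. \<mu> (fst w)) k A \<longrightarrow>
    (\<forall>g\<in>CK M. (\<forall>\<nu>\<in>J. \<nu> g = 0) \<longrightarrow> \<mu> g = 0))"
proof -
  let ?T = "prod_topology (C_w M) E"
  have w0: "w0 \<in> topspace ?T"
    using e0 CK_zero[OF M] by (simp add: w0_def topspace_C_w)
  define O' where "O' = topspace ?T \<inter> (\<Inter>a\<in>A. {w \<in> topspace ?T. \<Phi> w a \<in> ball (\<Phi> w0 a) (1 / Suc k)})"
  have "openin ?T {w \<in> topspace ?T. \<Phi> w a \<in> ball (\<Phi> w0 a) (1 / Suc k)}" if "a \<in> A" for a
  proof (rule openin_continuous_map_preimage)
    show "continuous_map ?T euclideanreal (\<lambda>w. \<Phi> w a)"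
      using continuous_map_compose[OF \<Phi> continuous_map_C_p_eval[of a K]] that A(2) by (auto simp: o_def)
  qed simp
  then have op: "openin ?T O'"
    unfolding O'_def using A(1) by (intro openin_Int_Inter finite_imageI openin_topspace) blast+
  have mem: "w \<in> O' \<longleftrightarrow> w \<in> topspace ?T \<and> (\<forall>a\<in>A. \<bar>\<Phi> w a - \<Phi> w0 a\<bar> < 1 / Suc k)" for w
    by (auto simp: O'_def dist_real_def abs_minus_commute)
  have "w0 \<in> O'" using w0 by (simp add: mem)
  then have "((\<lambda>x\<in>topspace M. 0), e0) \<in> O'" by (simp add: w0_def)
  from op[unfolded openin_prod_topology_alt, rule_format, OF this] obtain W E' where WE: "openin (C_w M) W" "openin E E'" "(\<lambda>x\<in>topspace M. 0) \<in> W" "e0 \<in> E'" "W \<times> E' \<subseteq> O'"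
    by blast
  obtain J where J: "finite J" "J \<subseteq> CK_dual M" "\<And>g. g \<in> CK M \<Longrightarrow> \<forall>\<nu>\<in>J. \<nu> g = 0 \<Longrightarrow> g \<in> W"
    using C_w_open_contains_kernel[OF M WE(1,3)] by auto
  have "\<mu> g = 0" if \<mu>: "\<mu> \<in> CK_dual M" "controls ?T \<Phi> w0 (\<lambda>w. \<mu> (fst w)) k A"
    and g: "g \<in> CK M" "\<forall>\<nu>\<in>J. \<nu> g = 0" for \<mu> g
  proof -
    have "\<bar>c * \<mu> g\<bar> \<le> 1" for c
    proof -
      let ?g = "\<lambda>x\<in>topspace M. c * g x"
      have "\<forall>\<nu>\<in>J. \<nu> ?g = 0" using J(2) g CK_dual_scale[OF _ g(1)] by fastforce
      then have "?g \<in> W" by (rule J(3)[OF CK_scale[OF M g(1)]])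
      then have "(?g, e0) \<in> O'" using WE(4,5) by blast
      then have "\<bar>\<mu> (fst (?g, e0))\<bar> \<le> 1" using \<mu>(2) unfolding controls_def mem by blast
      then show ?thesis using CK_dual_scale[OF \<mu>(1) g(1)] by simp
    qed
    \<comment> \<open>This multiple would turn a nonzero value into 2.\<close>
    from this[of "2 / \<mu> g"] show ?thesis by (cases "\<mu> g = 0") auto
  qed
  then show ?thesis using J(1,2) by (intro exI[of _ J]) blast
qed

section \<open>Decomposition of the cube by controlling tuples\<close>

lemma finite_dimensional_exhaustion:
  fixes K :: "'k topology"
  assumes "strongly_countable_dimensional K"
  shows "\<exists>(F :: nat \<Rightarrow> 'k set) d. (\<forall>n. closedin K (F n) \<and> covering_dim_le (subtopology K (F n)) (d n)) \<and>
    (\<Union>n. F n) = topspace K"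
proof -
  obtain \<F> where "countable \<F> \<and> (\<forall>F\<in>\<F>. closedin K F \<and> finite_dimensional_space (subtopology K F)) \<and>
      \<Union>\<F> = topspace K"
    using assms unfolding strongly_countable_dimensional_def by (elim conjE exE) auto
  then have F: "countable \<F>" "\<forall>F\<in>\<F>. closedin K F \<and> finite_dimensional_space (subtopology K F)"
    "\<Union>\<F> = topspace K" by simp_all
  \<comment> \<open>The empty piece is adjoined so that the family is nonempty and can be enumerated
    by all natural numbers.\<close>
  have "covering_dim_le (subtopology K {}) 0"
    unfolding covering_dim_le_def by (auto intro!: exI[of _ "{}"])
  then have empty: "finite_dimensional_space (subtopology K {})"
    unfolding finite_dimensional_space_def by (rule exI)
  have F': "\<forall>F\<in>insert {} \<F>. closedin K F \<and> finite_dimensional_space (subtopology K F)"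
  proof
    fix F assume "F \<in> insert {} \<F>"
    then show "closedin K F \<and> finite_dimensional_space (subtopology K F)"
    proof
      assume F: "F = {}"
      show ?thesis unfolding F using closedin_empty empty by (rule conjI)
    qed (rule F(2)[rule_format])
  qed
  define G where "G = from_nat_into (insert {} \<F>)"
  have ran: "range G = insert {} \<F>"
    unfolding G_def using F(1) by (intro range_from_nat_into) auto
  have G: "closedin K (G n) \<and> finite_dimensional_space (subtopology K (G n))" for n
    by (rule bspec[OF F', OF rangeI[of G n, unfolded ran]])
  then have "\<forall>n. \<exists>d. covering_dim_le (subtopology K (G n)) d"
    unfolding finite_dimensional_space_def by simp
  from choice[OF this] obtain d where d: "\<And>n. covering_dim_le (subtopology K (G n)) (d n)" by blast
  have "(\<Union>n. G n) = topspace K" using ran F(3) by simp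
  then show ?thesis using G d by (intro exI[of _ G] exI[of _ d]) simp
qed

text \<open>The pairs of a point \<open>p\<close> and a tuple controlling it form a compact space
  \<open>Z\<close>. Its maps to the entries of the tuple go into finite-dimensional pieces and have
  finite joint fibres, so covers of \<open>Z\<close> have refinements of bounded order; the fibre of
  the other projection over \<open>p\<close> is a copy of \<open>\<Y> p\<close>.\<close>

lemma controlling_tuples_cuttable:
  fixes K :: "'k topology" and \<psi> :: "(nat \<Rightarrow> real) \<Rightarrow> 't \<Rightarrow> real"
    and T :: "'t topology" and \<Phi> and w0 and X :: "nat \<Rightarrow> 'k set" and d :: "nat \<Rightarrow> nat"
    and k m r :: nat
  assumes K: "compact_space K" "Hausdorff_space K"
    and X: "\<And>j. closedin K (X j)" "\<And>j. covering_dim_le (subtopology K (X j)) (d j)"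
    and T: "w0 \<in> topspace T"
    and \<Phi>: "\<And>w. w \<in> topspace T \<Longrightarrow> \<Phi> w \<in> CK K"
    and \<psi>: "\<And>w. w \<in> topspace T \<Longrightarrow> continuous_on hilbert_cube (\<lambda>p. \<psi> p w)"
    and fin: "\<And>A. finite A \<Longrightarrow> A \<subseteq> topspace K \<Longrightarrow> finite {p \<in> hilbert_cube. controls T \<Phi> w0 (\<psi> p) k A}"
  defines "\<Y> p \<equiv> {y \<in> \<Pi>\<^sub>E j\<in>{..<m}. X j. controls T \<Phi> w0 (\<psi> p) k (y ` {..<m})}"
  shows "\<exists>N. cuttable N {p \<in> hilbert_cube. finite (\<Y> p) \<and> \<Y> p \<noteq> {} \<and> card (\<Y> p) \<le> r}"
proof -
  let ?P = "product_topology (\<lambda>j. subtopology K (X j)) {..<m}"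
  define Q where "Q = prod_topology (top_of_set hilbert_cube) ?P"
  have XK: "X j \<subseteq> topspace K" for j using X(1) closedin_subset by blast
  have top: "topspace Q = hilbert_cube \<times> (\<Pi>\<^sub>E j\<in>{..<m}. X j)"
    using XK by (simp add: Q_def inf_absorb2)
  have cX: "compact_space (subtopology K (X j)) \<and> Hausdorff_space (subtopology K (X j))" for j
    using X(1) K closedin_compact_space compact_space_subtopology Hausdorff_space_subtopology by blast
  have cQ: "compact_space Q" "Hausdorff_space Q"
    unfolding Q_def compact_space_prod_topology Hausdorff_space_prod_topology
      compact_space_product_topology Hausdorff_space_product_topology
    using cX compact_hilbert_cube by (auto simp: compact_space_subtopology Hausdorff_space_subtopology)
  define S where "S = {z \<in> topspace Q. controls T \<Phi> w0 (\<psi> (fst z)) k (snd z ` {..<m})}"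
  have c2: "continuous_map Q (subtopology K (X j)) (\<lambda>z. snd z j)" if "j < m" for j
    unfolding Q_def
    using continuous_map_compose[OF continuous_map_snd continuous_map_product_projection[of j "{..<m}" "\<lambda>j. subtopology K (X j)"]] that
    by (simp add: o_def)
  have c1: "continuous_map Q (top_of_set hilbert_cube) fst"
    unfolding Q_def by (rule continuous_map_fst)
  have "closedin Q S"
  proof -
    \<comment> \<open>For a single \<open>w\<close> the controlling implication becomes a finite
      union of closed conditions: either its conclusion holds or its premise fails at some
      entry.\<close>
    define C where "C w = {z \<in> topspace Q. \<psi> (fst z) w \<in> {-1..1}} \<union>
      (\<Union>j\<in>{..<m}. {z \<in> topspace Q. \<Phi> w (snd z j) - \<Phi> w0 (snd z j) \<in> - {-(1 / Suc k)<..<1 / Suc k}})" for w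
    have "closedin Q (C w)" if w: "w \<in> topspace T" for w
    proof -
      have "continuous_map (top_of_set hilbert_cube) euclideanreal (\<lambda>p. \<psi> p w)"
        using \<psi>[OF w] by simp
      from continuous_map_compose[OF c1 this]
      have "continuous_map Q euclideanreal (\<lambda>z. \<psi> (fst z) w)" by (simp add: o_def)
      then have 1: "closedin Q {z \<in> topspace Q. \<psi> (fst z) w \<in> {-1..1}}"
        by (rule closedin_continuous_map_preimage) simp
      have "closedin Q {z \<in> topspace Q. \<Phi> w (snd z j) - \<Phi> w0 (snd z j) \<in> - {-(1 / Suc k)<..<1 / Suc k}}"
        if j: "j < m" for j
      proof (rule closedin_continuous_map_preimage)
        have "continuous_map (subtopology K (X j)) euclideanreal (\<Phi> v)" if "v \<in> topspace T" for v
          using \<Phi>[OF that] K(1) by (simp add: CK_compact continuous_map_from_subtopology)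
        then have "continuous_map Q euclideanreal (\<lambda>z. \<Phi> v (snd z j))" if "v \<in> topspace T" for v
          using continuous_map_compose[OF c2[OF j]] that by (auto simp: o_def)
        then show "continuous_map Q euclideanreal (\<lambda>z. \<Phi> w (snd z j) - \<Phi> w0 (snd z j))"
          using w T by (intro continuous_map_diff) auto
      qed (simp add: closed_Compl)
      with 1 show ?thesis unfolding C_def by (intro closedin_Un closedin_Union) auto
    qed
    then have "closedin Q (\<Inter>w\<in>topspace T. C w)" using T by (intro closedin_INT) auto
    moreover have "S = (\<Inter>w\<in>topspace T. C w)"
    proof (intro set_eqI iffI)
      fix z assume z: "z \<in> S"
      have "z \<in> C w" if w: "w \<in> topspace T" for w
      proof (cases "\<forall>a\<in>snd z ` {..<m}. \<bar>\<Phi> w a - \<Phi> w0 a\<bar> < 1 / Suc k")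
        case True
        then have "\<bar>\<psi> (fst z) w\<bar> \<le> 1" using z w unfolding S_def controls_def by blast
        then show ?thesis using z by (auto simp: C_def S_def)
      next
        case False
        then obtain j where "j < m" "\<not> \<bar>\<Phi> w (snd z j) - \<Phi> w0 (snd z j)\<bar> < 1 / Suc k" by blast
        then have "\<Phi> w (snd z j) - \<Phi> w0 (snd z j) \<in> - {-(1 / Suc k)<..<1 / Suc k}" by auto
        then show ?thesis using z \<open>j < m\<close> unfolding C_def S_def by blast
      qed
      then show "z \<in> (\<Inter>w\<in>topspace T. C w)" by blast
    next
      fix z assume z: "z \<in> (\<Inter>w\<in>topspace T. C w)"
      then have "z \<in> C w0" using T by blast
      then have zQ: "z \<in> topspace Q" by (auto simp: C_def)
      have "\<bar>\<psi> (fst z) w\<bar> \<le> 1" if w: "w \<in> topspace T"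
        and lt: "\<forall>a\<in>snd z ` {..<m}. \<bar>\<Phi> w a - \<Phi> w0 a\<bar> < 1 / Suc k" for w
      proof -
        have "\<Phi> w (snd z j) - \<Phi> w0 (snd z j) \<in> {-(1 / Suc k)<..<1 / Suc k}" if "j < m" for j
        proof -
          have "\<bar>\<Phi> w (snd z j) - \<Phi> w0 (snd z j)\<bar> < 1 / Suc k" using lt that by blast
          then show ?thesis unfolding greaterThanLessThan_iff by linarith
        qed
        moreover have "z \<in> C w" using z w by blast
        ultimately have "\<psi> (fst z) w \<in> {-1..1}" unfolding C_def by blast
        then show ?thesis by auto
      qed
      then show "z \<in> S" using zQ unfolding S_def controls_def by blast
    qed
    ultimately show ?thesis by simp
  qed
  define Z where "Z = subtopology Q S"
  have SQ: "S \<subseteq> topspace Q" by (auto simp: S_def)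
  then have topZ: "topspace Z = S" by (simp add: Z_def inf_absorb2)
  have Z: "compact_space Z" "Hausdorff_space Z"
    using closedin_compact_space[OF cQ(1) \<open>closedin Q S\<close>] cQ(2)
    by (auto simp: Z_def compact_space_subtopology Hausdorff_space_subtopology)
  have "cuttable (r * ((\<Prod>j<m. d j + 1) * 1)) {p \<in> hilbert_cube. finite (\<Y> p) \<and> \<Y> p \<noteq> {} \<and> card (\<Y> p) \<le> r}"
  proof (rule cuttable_bounded_fibres[OF Z])
    have "continuous_map Z (top_of_set hilbert_cube) fst"
      unfolding Z_def using c1 by (rule continuous_map_from_subtopology)
    then show "continuous_map Z euclidean fst"
      using continuous_map_in_subtopology by blast
  next
    fix \<U> assume U: "\<forall>U\<in>\<U>. openin Z U" "\<Union>\<U> = topspace Z"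
    show "covered_with_order Z \<U> ((\<Prod>j<m. d j + 1) * 1) (topspace Z)"
    proof (rule covered_with_order_joint_fibres[where h = "\<lambda>j z. snd z j" and X = "\<lambda>j. subtopology K (X j)"])
      show "closedin Z (topspace Z)" by (rule closedin_topspace)
      fix x
      let ?R = "{z \<in> topspace Z. \<forall>j<m. snd z j = x j}"
      \<comment> \<open>A joint fibre fixes the tuple, leaving only the points controlled by one
        finite set. If it is nonempty, the entries lie in \<open>K\<close>, so \<open>fin\<close>
        applies.\<close>
      have "?R \<subseteq> {p \<in> hilbert_cube. controls T \<Phi> w0 (\<psi> p) k (x ` {..<m})} \<times> {restrict x {..<m}}"
      proof
        fix z assume z: "z \<in> ?R"
        then have "z \<in> S" "z \<in> topspace Q" and zx: "\<And>j. j < m \<Longrightarrow> snd z j = x j" using topZ SQ by auto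
        have "z \<in> hilbert_cube \<times> (\<Pi>\<^sub>E j\<in>{..<m}. X j)"
          using \<open>z \<in> topspace Q\<close> by (simp only: top)
        then have "snd z \<in> extensional {..<m}" "fst z \<in> hilbert_cube"
          unfolding mem_Times_iff PiE_iff by blast+
        moreover have "snd z = restrict x {..<m}"
          using calculation(1) zx by (intro extensionalityI[of _ "{..<m}"]) auto
        moreover have "snd z ` {..<m} = x ` {..<m}" using zx by (intro image_cong) auto
        ultimately show "z \<in> {p \<in> hilbert_cube. controls T \<Phi> w0 (\<psi> p) k (x ` {..<m})} \<times> {restrict x {..<m}}"
          using \<open>z \<in> S\<close> by (cases z) (auto simp: S_def)
      qed
      moreover have "finite {p \<in> hilbert_cube. controls T \<Phi> w0 (\<psi> p) k (x ` {..<m})}" if ne: "?R \<noteq> {}"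
      proof (rule fin)
        obtain z where "z \<in> ?R" using ne by blast
        then have z: "z \<in> topspace Q" "\<And>j. j < m \<Longrightarrow> snd z j = x j" using topZ SQ by auto
        then have "x j \<in> X j" if "j < m" for j
          using that z(2)[OF that] unfolding top mem_Times_iff PiE_iff by auto
        then show "x ` {..<m} \<subseteq> topspace K" using XK by blast
      qed simp
      ultimately have finR: "finite ?R" if "?R \<noteq> {}"
        using that by (meson finite.intros finite_SigmaI finite_subset)
      have "finite ?R"
      proof (cases "?R = {}")
        case True
        show ?thesis unfolding True by (rule finite.emptyI)
      qed (rule finR)
      then show "covered_with_order Z \<U> 1 ?R"
        using U by (intro covered_with_order_finite[OF Z(2)]) auto
    qed (use Z(1) cX X(2) c2 in \<open>auto simp: Z_def continuous_map_from_subtopology\<close>)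
  next
    fix p assume p: "p \<in> {p \<in> hilbert_cube. finite (\<Y> p) \<and> \<Y> p \<noteq> {} \<and> card (\<Y> p) \<le> r}"
    have pc: "p \<in> hilbert_cube" using p by blast
    have "(q, y) \<in> {z \<in> topspace Z. fst z = p} \<longleftrightarrow> (q, y) \<in> Pair p ` \<Y> p" for q y
      unfolding topZ S_def top \<Y>_def image_iff using pc by auto
    then have "{z \<in> topspace Z. fst z = p} = Pair p ` \<Y> p"
      by (simp only: set_eq_iff split_paired_All simp_thms)
    moreover have "inj_on (Pair p) (\<Y> p)" by (auto simp: inj_on_def)
    ultimately show "finite {z \<in> topspace Z. fst z = p} \<and> {z \<in> topspace Z. fst z = p} \<noteq> {} \<and>
        card {z \<in> topspace Z. fst z = p} \<le> r"
      using p by (simp add: card_image)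
  qed
  then show ?thesis by blast
qed

theorem theorem4p1:
  fixes K :: "'k topology" and L :: "'l topology" and M :: "'m topology" and E :: "'e topology"
  assumes "compact_space K" "Hausdorff_space K" "strongly_countable_dimensional K"
    and "compact_space L" "Hausdorff_space L"
    and "compact_space M" "metrizable_space M" "uncountable (topspace M)"
    and "tychonoff_space E"
    and "C_w L homeomorphic_space prod_topology (C_w M) E"
  shows "\<not> (C_p K homeomorphic_space C_w L)"
proof
  assume "C_p K homeomorphic_space C_w L"
  note K = assms(1,2) and M = assms(6)
  let ?T = "prod_topology (C_w M) E"
  have "?T homeomorphic_space C_p K"
    using homeomorphic_space_trans[OF \<open>C_p K homeomorphic_space C_w L\<close> assms(10)] homeomorphic_space_sym by blast
  then obtain \<Phi> where \<Phi>: "homeomorphic_map ?T (C_p K) \<Phi>" unfolding homeomorphic_space by blast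
  have surj: "\<Phi> ` topspace ?T = CK K"
    using \<Phi> homeomorphic_imp_surjective_map topspace_C_p by blast
  \<comment> \<open>The zero function on \<open>K\<close> has a preimage, so \<open>E\<close> has a
    point to complete the origin of \<open>C(M)\<close>.\<close>
  have "topspace ?T \<noteq> {}" using surj CK_zero[OF K(1)] by blast
  then obtain e0 where e0: "e0 \<in> topspace E"
    unfolding topspace_prod_topology by blast
  let ?z = "\<lambda>x\<in>topspace M. 0::real"
  define w0 where "w0 = (?z, e0)"
  have w0: "w0 \<in> topspace ?T" using e0 CK_zero[OF M] by (simp add: w0_def topspace_C_w)
  have "infinite (topspace M)" using assms(8) countable_finite by blast
  from independent_hilbert_cube_of_functionals[OF M assms(7) this]
  obtain \<mu> :: "(nat \<Rightarrow> real) \<Rightarrow> ('m \<Rightarrow> real) \<Rightarrow> real"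
    where "(\<forall>p\<in>hilbert_cube. \<mu> p \<in> CK_dual M) \<and>
    (\<forall>g\<in>CK M. continuous_on hilbert_cube (\<lambda>p. \<mu> p g)) \<and>
    (\<forall>J. finite J \<and> J \<subseteq> CK_dual M \<longrightarrow>
       finite {p \<in> hilbert_cube. \<forall>g\<in>CK M. (\<forall>\<nu>\<in>J. \<nu> g = 0) \<longrightarrow> \<mu> p g = 0})" ..
  then have \<mu>: "\<And>p. p \<in> hilbert_cube \<Longrightarrow> \<mu> p \<in> CK_dual M"
    "\<And>g. g \<in> CK M \<Longrightarrow> continuous_on hilbert_cube (\<lambda>p. \<mu> p g)"
    "\<And>J. finite J \<Longrightarrow> J \<subseteq> CK_dual M \<Longrightarrow>
       finite {p \<in> hilbert_cube. \<forall>g\<in>CK M. (\<forall>\<nu>\<in>J. \<nu> g = 0) \<longrightarrow> \<mu> p g = 0}"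
    by simp_all
  define \<psi> where "\<psi> p w = \<mu> p (fst w)" for p and w :: "('m \<Rightarrow> real) \<times> 'e"
  let ?ctrl = "\<lambda>p. controls ?T \<Phi> w0 (\<psi> p)"
  have \<psi>: "continuous_map ?T euclideanreal (\<psi> p)" "\<psi> p w0 = 0" if "p \<in> hilbert_cube" for p
  proof -
    show "continuous_map ?T euclideanreal (\<psi> p)"
      using continuous_map_compose[OF continuous_map_fst continuous_map_CK_dual[OF \<mu>(1)[OF that]]]
      by (simp add: \<psi>_def[abs_def] o_def)
    show "\<psi> p w0 = 0" using CK_dual_zero[OF M \<mu>(1)[OF that]] by (simp add: \<psi>_def w0_def)
  qed
  have fin: "finite {p \<in> hilbert_cube. ?ctrl p k A}" if A: "finite A" "A \<subseteq> topspace K" for A k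
  proof -
    have "continuous_map ?T (C_p K) \<Phi>" using \<Phi> homeomorphic_imp_continuous_map by blast
    from controls_kernel[OF M A this e0, of k, folded w0_def]
    obtain J where J: "finite J" "J \<subseteq> CK_dual M" "\<And>\<nu> g. \<nu> \<in> CK_dual M \<Longrightarrow>
        controls ?T \<Phi> w0 (\<lambda>w. \<nu> (fst w)) k A \<Longrightarrow> g \<in> CK M \<Longrightarrow> \<forall>\<nu>\<in>J. \<nu> g = 0 \<Longrightarrow> \<nu> g = 0"
      by blast
    have "{p \<in> hilbert_cube. ?ctrl p k A} \<subseteq>
        {p \<in> hilbert_cube. \<forall>g\<in>CK M. (\<forall>\<nu>\<in>J. \<nu> g = 0) \<longrightarrow> \<mu> p g = 0}"
    proof (intro subsetI CollectI conjI ballI impI; elim CollectE conjE)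
      fix p g assume "p \<in> hilbert_cube" "?ctrl p k A" "g \<in> CK M" "\<forall>\<nu>\<in>J. \<nu> g = 0"
      then show "\<mu> p g = 0" using J(3)[OF \<mu>(1)] by (simp add: \<psi>_def[abs_def])
    qed
    then show ?thesis using \<mu>(3)[OF J(1,2)] by (rule finite_subset)
  qed
  from finite_dimensional_exhaustion[OF assms(3)] obtain F :: "nat \<Rightarrow> 'k set" and d
    where "(\<forall>n. closedin K (F n) \<and> covering_dim_le (subtopology K (F n)) (d n)) \<and> (\<Union>n. F n) = topspace K"
    by blast
  then have F: "\<And>n. closedin K (F n)" "\<And>n. covering_dim_le (subtopology K (F n)) (d n)"
    "(\<Union>n. F n) = topspace K"
    by simp_all
  define tuples where "tuples k js p = {y \<in> \<Pi>\<^sub>E j\<in>{..<length js}. F (js ! j). ?ctrl p k (y ` {..<length js})}"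
    for k :: nat and js :: "nat list" and p
  \<comment> \<open>The triples form a countable type: \<open>k\<close> gives the radius,
    \<open>js\<close> names a piece of \<open>K\<close> for each entry, and \<open>r\<close> bounds
    the number of controlling tuples.\<close>
  define Y where "Y = (\<lambda>(k, js, r). {p \<in> hilbert_cube. finite (tuples k js p) \<and> tuples k js p \<noteq> {} \<and> card (tuples k js p) \<le> r})"
  have "\<exists>N. cuttable N (Y t)" for t
  proof -
    obtain k js r where t: "t = (k, js, r)" by (cases t)
    show ?thesis
      unfolding t Y_def prod.case tuples_def
    proof (rule controlling_tuples_cuttable[where d = "\<lambda>j. d (js ! j)" and X = "\<lambda>j. F (js ! j)"])
      show "continuous_on hilbert_cube (\<lambda>p. \<psi> p w)" if "w \<in> topspace ?T" for w
        using that \<mu>(2) by (auto simp: \<psi>_def topspace_C_w)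
    qed (use K F w0 surj fin in auto)
  qed
  then have "\<not> hilbert_cube \<subseteq> (\<Union>n::nat. Y (from_nat n))"
    by (intro hilbert_cube_not_countable_Union_cuttable)
  moreover have "p \<in> (\<Union>n::nat. Y (from_nat n))" if p: "p \<in> hilbert_cube" for p
  proof -
    obtain k A0 where A0: "finite A0" "A0 \<subseteq> topspace K" "?ctrl p k A0"
      using controls_exists[OF \<Phi> w0 \<psi>[OF p]] by blast
    define P where "P A \<longleftrightarrow> finite A \<and> A \<subseteq> topspace K \<and> ?ctrl p k A" for A
    have "P A0" using A0 by (simp add: P_def)
    \<comment> \<open>Least size is meant for the radius index \<open>k\<close> already
      fixed.\<close>
    then obtain A where A: "P A" "\<And>B. P B \<Longrightarrow> card A \<le> card B"
      using ex_has_least_nat[of P A0 card] by blast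
    define m where "m = card A"
    define \<A> where "\<A> = {A. finite A \<and> A \<subseteq> topspace K \<and> card A = m \<and> ?ctrl p k A}"
    have fin\<A>: "finite \<A>"
      unfolding \<A>_def
      by (rule finite_minimal_controls[OF K \<Phi> w0 \<psi>(1)[OF p]]) (use A(2) in \<open>auto simp: P_def m_def\<close>)
    have "finite A" using A(1) by (simp add: P_def)
    then obtain y where y: "bij_betw y {..<m} A"
      using ex_bij_betw_nat_finite[of A] unfolding m_def atLeast0LessThan by blast
    then have yA: "y ` {..<m} = A" by (simp add: bij_betw_def)
    have "\<forall>j\<in>{..<m}. \<exists>n. y j \<in> F n"
      using yA A(1) F(3) unfolding P_def by blast
    from bchoice[OF this] obtain c where c: "\<And>j. j < m \<Longrightarrow> y j \<in> F (c j)" by blast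
    define js where "js = map c [0..<m]"
    have len: "length js = m" and nth: "\<And>j. j < m \<Longrightarrow> js ! j = c j" by (simp_all add: js_def)
    have "restrict y {..<m} \<in> tuples k js p"
      using yA A(1) c by (auto simp: tuples_def len nth P_def)
    \<comment> \<open>The entries of such a tuple form a controlling set of at most \<open>m\<close>
      points, hence by minimality of exactly \<open>m\<close>. There are finitely many such sets, so
      finitely many tuples.\<close>
    moreover have "tuples k js p \<subseteq> (\<Pi>\<^sub>E j\<in>{..<m}. \<Union>\<A>)"
    proof
      fix v assume v: "v \<in> tuples k js p"
      let ?B = "v ` {..<m}"
      have ext: "v \<in> extensional {..<m}" "?ctrl p k ?B" using v by (auto simp: tuples_def len PiE_iff)
      have "v j \<in> F (js ! j)" if "j < m" for j using v that by (auto simp: tuples_def len PiE_iff)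
      then have BK: "?B \<subseteq> topspace K" using F(3) by blast
      then have "m \<le> card ?B" unfolding m_def using ext(2) by (intro A(2)) (simp add: P_def m_def)
      moreover have "card ?B \<le> m" using card_image_le[of "{..<m}" v] by simp
      ultimately have "?B \<in> \<A>" using BK ext(2) by (simp add: \<A>_def)
      then have "?B \<subseteq> \<Union>\<A>" by (rule Union_upper)
      then show "v \<in> (\<Pi>\<^sub>E j\<in>{..<m}. \<Union>\<A>)" using ext(1) by (auto simp: PiE_iff)
    qed
    moreover have "finite (\<Pi>\<^sub>E j\<in>{..<m}. \<Union>\<A>)"
      using fin\<A> by (intro finite_PiE) (auto simp: \<A>_def)
    ultimately have "p \<in> Y (k, js, card (tuples k js p))"
      using p finite_subset unfolding Y_def by auto
    then have "p \<in> Y (from_nat (to_nat (k, js, card (tuples k js p))))" by simp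
    then show ?thesis by blast
  qed
  ultimately show False by blast
qed

end
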